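(* Let $\Gamma\subset\mathbb{R}^d$ be an acute closed convex solid cone and let $\mu$ be a positive measure of moderate growth defined on $\Gamma^*$. Fix a point $\lambda\in\operatorname{int}\Gamma$. For every $n\in\mathbb{N}$, there exists a Wigner distribution associated to a $d$-tuple of real symmetric matrices, such that its Laplace transform $F_n(z)$ matches the Taylor coefficients of the Laplace transform $$F(z)=\int_{\Gamma^*}e^{-z\cdot x}\,d\mu(x),\qquad \operatorname{Re}z\in\operatorname{int}\Gamma,$$ up to order $2n+1$ at $z=\lambda$. The functions $F_n$ are entire of exponential type, and they are directional exponential sums on the affine cone $\lambda+\Gamma$. Moreover, the sequence $(F_n)_n$ converges to $F$ on the open tube domain $T_{\lambda+\Gamma}=(\lambda+\operatorname{int}\Gamma)+i\,\mathbb{R}^d$ associated with the cone $\lambda+\Gamma$, in the Fréchet topology of uniform convergence on compact subsets.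
   Context: $\Gamma\subset\mathbb{R}^d$ is a closed convex cone with vertex $0$, acute (containing no line) and solid (with non-empty interior); $\Gamma^*=\{y\in\mathbb{R}^d: y\cdot x\ge 0 \text{ for } x\in\Gamma\}$ is its closed dual cone. A nonnegative measure $\mu$ supported in $\Gamma^*$ is of moderate growth if $e^{-p\cdot x}\in L^1(\Gamma^*,\mu)$ for every $p\in\operatorname{int}\Gamma$. For $z\in\mathbb{C}^d$, $z\cdot x=\sum_j z_jx_j$. Wigner distribution: for a $d$-tuple $A=(A_1,\dots,A_d)$ of self-adjoint (not necessarily commuting) matrices acting on a finite-dimensional real Hilbert space $H$ and a vector $u\in H$, $\mathcal{W}_u(A)$ is the compactly supported distribution on $\mathbb{R}^d$ given by $(\mathcal{W}_u(A)(\xi),\phi(x\cdot\xi))=\langle\phi(x\cdot A)u,u\rangle$ for $x\in\mathbb{R}^d$ and smooth functions $\phi$, where $x\cdot A=\sum_j x_jA_j$ and $\phi(x\cdot A)$ is given by the self-adjoint functional calculus. The Laplace transform of a compactly supported distribution $\mathcal{W}$ on $\mathbb{R}^d$ is $z\mapsto(\mathcal{W}(\xi),e^{-z\cdot\xi})$. Directional exponential sum: a function $f$ on the affine cone $\lambda+\Gamma$ (with vertex $\lambda$) is a directional exponential sum if for each $\omega\in\Gamma$ the function $t\mapsto f(\lambda+t\omega)$, $t\in[0,\infty)$, is a finite sum $\sum_{j=1}^N c_j e^{-\gamma_j t}$ for some non-negative real numbers $c_j$ and $\gamma_j$ (which may depend on $\omega$). *)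

theory Defs
  imports "HOL-Analysis.Analysis" "HOL-Complex_Analysis.Complex_Analysis"
    "Jordan_Normal_Form.Determinant"
begin

no_notation vec_index (infixl "$" 100)
no_notation scalar_prod (infix "\<bullet>" 70)
hide_const (open) Matrix.mat Matrix.vec Matrix.row Matrix.col

section \<open>Cones and measures\<close>

definition acute :: "'a::real_vector set \<Rightarrow> bool" where
  "acute S \<longleftrightarrow> \<not> (\<exists>a v. v \<noteq> 0 \<and> (\<forall>t::real. a + t *\<^sub>R v \<in> S))"

definition dual_cone :: "'a::real_inner set \<Rightarrow> 'a set" where
  "dual_cone S = {y. \<forall>x\<in>S. y \<bullet> x \<ge> 0}"

text \<open>As the dual cone is closed, a Borel measure is supported in it iff its complement is null.\<close>

definition moderate_growth :: "'a::euclidean_space set \<Rightarrow> 'a measure \<Rightarrow> bool" where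
  "moderate_growth S M \<longleftrightarrow> sets M = sets borel \<and> emeasure M (- dual_cone S) = 0 \<and>
     (\<forall>p\<in>interior S. set_integrable M (dual_cone S) (\<lambda>x. exp (- (p \<bullet> x))))"

section \<open>Functions on complex coordinate space\<close>

text \<open>The bilinear (not sesquilinear) pairing of a complex with a real vector.\<close>

definition cdot :: "complex^'d \<Rightarrow> real^'d \<Rightarrow> complex" where
  "cdot z x = (\<Sum>j\<in>UNIV. z $ j * complex_of_real (x $ j))"

definition cvec :: "real^'d \<Rightarrow> complex^'d" where
  "cvec x = (\<chi> j. complex_of_real (x $ j))"

definition Re_vec :: "complex^'d \<Rightarrow> real^'d" where
  "Re_vec z = (\<chi> j. Re (z $ j))"

definition tube :: "(real^'d) set \<Rightarrow> (complex^'d) set" where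
  "tube S = {z. Re_vec z \<in> S}"

definition laplace_measure :: "(real^'d) set \<Rightarrow> (real^'d) measure \<Rightarrow> complex^'d \<Rightarrow> complex" where
  "laplace_measure S M z = (LINT x:dual_cone S|M. exp (- cdot z x))"

text \<open>Holomorphic on the whole space: real Frechet differentiable with complex-linear derivative.\<close>

definition entire :: "(complex^'d \<Rightarrow> complex) \<Rightarrow> bool" where
  "entire f \<longleftrightarrow> (\<forall>z. \<exists>L. (f has_derivative L) (at z) \<and> (\<forall>c v. L (c *s v) = c * L v))"

definition exponential_type :: "(complex^'d \<Rightarrow> complex) \<Rightarrow> bool" where
  "exponential_type f \<longleftrightarrow> (\<exists>B C. \<forall>z. norm (f z) \<le> C * exp (B * norm z))"

definition cpartial :: "'d \<Rightarrow> (complex^'d \<Rightarrow> complex) \<Rightarrow> complex^'d \<Rightarrow> complex" where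
  "cpartial j f z = deriv (\<lambda>w. f (z + axis j w)) 0"

text \<open>The multi-index \<open>\<alpha>\<close> is encoded by any list in which each \<open>j\<close> occurs \<open>\<alpha>\<^sub>j\<close> times;
  its order is the length of the list.\<close>

definition taylor_coeff :: "'d list \<Rightarrow> (complex^'d \<Rightarrow> complex) \<Rightarrow> complex^'d \<Rightarrow> complex" where
  "taylor_coeff js f a = foldr cpartial js f a / (\<Prod>j\<in>UNIV. fact (count_list js j))"

definition directional_exp_sum :: "(real^'d) set \<Rightarrow> real^'d \<Rightarrow> (real^'d \<Rightarrow> complex) \<Rightarrow> bool" where
  "directional_exp_sum S a f \<longleftrightarrow>
     (\<forall>w\<in>S. \<exists>(N::nat) (c::nat \<Rightarrow> real) (\<gamma>::nat \<Rightarrow> real).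
        (\<forall>j<N. c j \<ge> 0 \<and> \<gamma> j \<ge> 0) \<and>
        (\<forall>t\<ge>0. f (a + t *\<^sub>R w) = complex_of_real (\<Sum>j<N. c j * exp (- \<gamma> j * t))))"

section \<open>Compactly supported distributions\<close>

primrec C_k :: "nat \<Rightarrow> ('a::real_normed_vector \<Rightarrow> 'b::real_normed_vector) \<Rightarrow> bool" where
  "C_k 0 f \<longleftrightarrow> continuous_on UNIV f"
| "C_k (Suc k) f \<longleftrightarrow> (\<forall>x. f differentiable (at x)) \<and>
     (\<forall>v. C_k k (\<lambda>x. frechet_derivative f (at x) v))"

definition smooth :: "('a::real_normed_vector \<Rightarrow> 'b::real_normed_vector) \<Rightarrow> bool" where
  "smooth f \<longleftrightarrow> (\<forall>k. C_k k f)"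

definition rpartial :: "'d \<Rightarrow> (real^'d \<Rightarrow> complex) \<Rightarrow> real^'d \<Rightarrow> complex" where
  "rpartial j f x = frechet_derivative f (at x) (axis j 1)"

text \<open>Compactly supported distributions are the continuous linear functionals on the space of all
  smooth functions with its usual Frechet topology. Functionals are total functions here, and
  their values at non-smooth arguments are irrelevant.\<close>

definition compact_distribution :: "((real^'d \<Rightarrow> complex) \<Rightarrow> complex) \<Rightarrow> bool" where
  "compact_distribution W \<longleftrightarrow>
     (\<forall>f g. smooth f \<longrightarrow> smooth g \<longrightarrow> W (\<lambda>x. f x + g x) = W f + W g) \<and>
     (\<forall>c f. smooth f \<longrightarrow> W (\<lambda>x. c * f x) = c * W f) \<and>
     (\<exists>K (N::nat) C. compact K \<and> (\<forall>f B. smooth f \<longrightarrow> B \<ge> 0 \<longrightarrow>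
        (\<forall>js x. length js \<le> N \<longrightarrow> x \<in> K \<longrightarrow> norm (foldr rpartial js f x) \<le> B) \<longrightarrow>
        norm (W f) \<le> C * B))"

definition laplace_distribution ::
    "((real^'d \<Rightarrow> complex) \<Rightarrow> complex) \<Rightarrow> complex^'d \<Rightarrow> complex" where
  "laplace_distribution W z = W (\<lambda>\<xi>. exp (- cdot z \<xi>))"

section \<open>Wigner distributions\<close>

definition real_symmetric :: "nat \<Rightarrow> real mat \<Rightarrow> bool" where
  "real_symmetric m S \<longleftrightarrow> S \<in> carrier_mat m m \<and> transpose_mat S = S"

text \<open>\<open>T = \<phi>(S)\<close>, computed in an orthonormal basis of eigenvectors of \<open>S\<close>, namely the columns
  of \<open>Q\<close>.\<close>

definition is_fun_calc :: "(real \<Rightarrow> complex) \<Rightarrow> real mat \<Rightarrow> complex mat \<Rightarrow> bool" where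
  "is_fun_calc \<phi> S T \<longleftrightarrow> (\<exists>m Q e. Q \<in> carrier_mat m m \<and> Q * transpose_mat Q = 1\<^sub>m m \<and>
     S = Q * mat_diag m e * transpose_mat Q \<and>
     T = map_mat complex_of_real Q * mat_diag m (\<lambda>i. \<phi> (e i))
           * map_mat complex_of_real (transpose_mat Q))"

definition fun_calc :: "(real \<Rightarrow> complex) \<Rightarrow> real mat \<Rightarrow> complex mat" where
  "fun_calc \<phi> S = (THE T. is_fun_calc \<phi> S T)"

text \<open>The result does not depend on the choice of the eigenbasis.\<close>

lemma is_fun_calc_unique:
  assumes "is_fun_calc \<phi> S T" and "is_fun_calc \<phi> S T'"
  shows "T = T'"
proof -
  let ?c = "map_mat complex_of_real"
  obtain m Q e where Q: "Q \<in> carrier_mat m m" and QQ: "Q * transpose_mat Q = 1\<^sub>m m"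
    and S: "S = Q * mat_diag m e * transpose_mat Q"
    and T: "T = ?c Q * mat_diag m (\<lambda>i. \<phi> (e i)) * ?c (transpose_mat Q)"
    using assms(1) unfolding is_fun_calc_def by blast
  obtain m' P f where P': "P \<in> carrier_mat m' m'" and PP': "P * transpose_mat P = 1\<^sub>m m'"
    and S'': "S = P * mat_diag m' f * transpose_mat P"
    and T'': "T' = ?c P * mat_diag m' (\<lambda>i. \<phi> (f i)) * ?c (transpose_mat P)"
    using assms(2) unfolding is_fun_calc_def by blast
  have "dim_row S = m" using S Q by simp
  moreover have "dim_row S = m'" using S'' P' by simp
  ultimately have mm: "m' = m" by simp
  note P = P'[unfolded mm] and PP = PP'[unfolded mm] and S' = S''[unfolded mm]
    and T' = T''[unfolded mm]
  let ?D = "mat_diag m e" and ?E = "mat_diag m f"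
  let ?Qt = "transpose_mat Q" and ?Pt = "transpose_mat P"
  have ct: "?Qt \<in> carrier_mat m m" "?Pt \<in> carrier_mat m m" using Q P by auto
  have QtQ: "?Qt * Q = 1\<^sub>m m" by (rule mat_mult_left_right_inverse[OF Q ct(1) QQ])
  have PtP: "?Pt * P = 1\<^sub>m m" by (rule mat_mult_left_right_inverse[OF P ct(2) PP])
  define R where "R = ?Pt * Q"
  have R: "R \<in> carrier_mat m m" using ct Q unfolding R_def by auto
  have "?Pt * S * Q = R * ?D"
  proof -
    have "?Pt * S * Q = ?Pt * (Q * ?D * ?Qt * Q)"
      using Q ct unfolding S by (simp add: assoc_mult_mat[of _ m m _ m _ m] mult_carrier_mat[of _ m m _ m])
    also have "Q * ?D * ?Qt * Q = Q * ?D * (?Qt * Q)"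
      using Q ct by (simp add: assoc_mult_mat[of _ m m _ m _ m] mult_carrier_mat[of _ m m _ m])
    also have "?Pt * (Q * ?D * (?Qt * Q)) = R * ?D"
      unfolding QtQ R_def using Q ct by (simp add: right_mult_one_mat[of _ m m] assoc_mult_mat[of _ m m _ m _ m] mult_carrier_mat[of _ m m _ m])
    finally show ?thesis .
  qed
  moreover have "?Pt * S * Q = ?E * R"
  proof -
    have "?Pt * S * Q = (?Pt * P) * (?E * (?Pt * Q))"
      using Q P ct unfolding S' by (simp add: assoc_mult_mat[of _ m m _ m _ m] mult_carrier_mat[of _ m m _ m])
    also have "\<dots> = ?E * R"
      unfolding PtP R_def using Q ct by (simp add: left_mult_one_mat[of _ m m] mult_carrier_mat[of _ m m _ m])
    finally show ?thesis .
  qed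
  ultimately have RD: "R * ?D = ?E * R" by simp
  have ent: "R $$ (i, j) * e j = f i * R $$ (i, j)" if "i < m" "j < m" for i j
    using arg_cong[OF RD, of "\<lambda>M. M $$ (i, j)"] that
    by (simp add: mat_diag_mult_left[OF R] mat_diag_mult_right[OF R])
  let ?PD = "mat_diag m (\<lambda>i. \<phi> (e i))" and ?PE = "mat_diag m (\<lambda>i. \<phi> (f i))"
  have cR: "?c R \<in> carrier_mat m m" using R by simp
  have RP: "?c R * ?PD = ?PE * ?c R"
  proof (rule eq_matI)
    fix i j assume "i < dim_row (?PE * ?c R)" "j < dim_col (?PE * ?c R)"
    then have ij: "i < m" "j < m" using R by (auto simp: mat_diag_def)
    have "e j = f i" if "R $$ (i, j) \<noteq> 0" using ent[OF ij] that by simp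
    then show "(?c R * ?PD) $$ (i, j) = (?PE * ?c R) $$ (i, j)"
      using ij R by (cases "R $$ (i, j) = 0")
        (auto simp: mat_diag_mult_left[OF cR] mat_diag_mult_right[OF cR])
  qed (use R in \<open>auto simp: mat_diag_def\<close>)
  have cc: "?c Q \<in> carrier_mat m m" "?c P \<in> carrier_mat m m"
    "?c ?Qt \<in> carrier_mat m m" "?c ?Pt \<in> carrier_mat m m" using Q P by auto
  have hom: "?c (X * Y) = ?c X * ?c Y"
    if "X \<in> carrier_mat m m" "Y \<in> carrier_mat m m" for X Y
    by (rule eq_matI) (use that in \<open>auto simp: scalar_prod_def\<close>)
  have one: "?c (1\<^sub>m m) = 1\<^sub>m m" by (rule eq_matI) auto
  have cRe: "?c R = ?c ?Pt * ?c Q" unfolding R_def by (rule hom[OF ct(2) Q])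
  have cPP: "?c P * ?c ?Pt = 1\<^sub>m m" using hom[OF P ct(2)] PP one by simp
  have cQQ: "?c Q * ?c ?Qt = 1\<^sub>m m" using hom[OF Q ct(1)] QQ one by simp
  note as = assoc_mult_mat[of _ m m _ m _ m] mult_carrier_mat[of _ m m _ m]
  have "T = (?c P * ?c ?Pt) * (?c Q * ?PD * ?c ?Qt)"
    unfolding cPP T using cc by (simp add: left_mult_one_mat[of _ m m] mult_carrier_mat[of _ m m _ m])
  also have "\<dots> = ?c P * ((?c ?Pt * ?c Q) * ?PD) * ?c ?Qt"
    using cc by (simp add: as)
  also have "\<dots> = ?c P * (?PE * (?c ?Pt * ?c Q)) * ?c ?Qt"
    using RP unfolding cRe by simp
  also have "\<dots> = ?c P * ?PE * ?c ?Pt * (?c Q * ?c ?Qt)"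
    using cc by (simp add: as)
  also have "\<dots> = T'"
    unfolding cQQ T' using cc by (simp add: as right_mult_one_mat[of _ m m])
  finally show ?thesis .
qed

definition lin_comb :: "nat \<Rightarrow> real^'d \<Rightarrow> ('d \<Rightarrow> real mat) \<Rightarrow> real mat" where
  "lin_comb m x A = Matrix.mat m m (\<lambda>(i, k). \<Sum>j\<in>UNIV. x $ j * A j $$ (i, k))"

text \<open>Since test functions are complex valued, \<open>\<phi>(x\<cdot>A)\<close> acts on the complexification of
  \<open>\<real>\<^sup>m\<close>, with the inner product linear in its first argument.\<close>

definition wigner_distribution ::
    "nat \<Rightarrow> ('d \<Rightarrow> real mat) \<Rightarrow> real Matrix.vec \<Rightarrow> ((real^'d \<Rightarrow> complex) \<Rightarrow> complex) \<Rightarrow> bool" where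
  "wigner_distribution m A u W \<longleftrightarrow>
     (\<forall>j. real_symmetric m (A j)) \<and> u \<in> carrier_vec m \<and> compact_distribution W \<and>
     (\<forall>x \<phi>. smooth \<phi> \<longrightarrow>
        W (\<lambda>\<xi>. \<phi> (x \<bullet> \<xi>)) =
        (fun_calc \<phi> (lin_comb m x A) *\<^sub>v map_vec complex_of_real u) \<bullet>c map_vec complex_of_real u)"

end

theory Submission
  imports Defs
begin

text \<open>The Wigner distributions can be taken commutative: for diagonal matrices \<open>A\<^sub>j\<close> they are exactly
  the positive measures with finite support. By Tchakaloff's theorem, the finite measure
  \<open>exp (- p\<cdot>x) d\<mu>\<close>, all of whose moments exist because \<open>p\<close> is interior to the cone, has the same
  moments up to order \<open>2n+1\<close> as some measure with finitely many atoms, all in the dual cone. Its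
  Laplace transform, translated by \<open>p\<close>, is \<open>F n\<close>; atoms in the dual cone make it a directional
  exponential sum. For convergence, put \<open>b = z - p\<close>, whose real part pairs nonnegatively with the
  dual cone, and let \<open>t\<close> go from 0 to 1 in \<open>exp (- t b\<cdot>x)\<close> by steps of fixed length: at each step all
  mixed moments \<open>\<integral>(b\<cdot>x)\<^sup>k exp (- t b\<cdot>x)\<close> converge, because in the right half plane the Taylor
  remainder of the exponential is controlled by the moments of \<open>p\<cdot>x\<close>, which grow at most
  like \<open>\<sigma>\<^sup>k k!\<close>.\<close>

section \<open>Tchakaloff's theorem\<close>

lemma integrable_mult_pair:
  fixes f g :: "_ \<Rightarrow> real"
  assumes "finite_measure M" "finite_measure N" and f: "integrable M f" and g: "integrable N g"
  shows "integrable (M \<Otimes>\<^sub>M N) (\<lambda>p. f (fst p) * g (snd p))"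
    and "(\<integral>p. f (fst p) * g (snd p) \<partial>(M \<Otimes>\<^sub>M N)) = (\<integral>x. f x \<partial>M) * (\<integral>y. g y \<partial>N)"
proof -
  interpret M: finite_measure M by fact
  interpret N: finite_measure N by fact
  interpret pair_sigma_finite M N ..
  note [measurable] = borel_measurable_integrable[OF f] borel_measurable_integrable[OF g]
  show *: "integrable (M \<Otimes>\<^sub>M N) (\<lambda>p. f (fst p) * g (snd p))"
    by (rule Fubini_integrable) (use f g in \<open>auto simp: abs_mult\<close>)
  show "(\<integral>p. f (fst p) * g (snd p) \<partial>(M \<Otimes>\<^sub>M N)) = (\<integral>x. f x \<partial>M) * (\<integral>y. g y \<partial>N)"
    using integral_fst'[OF *] by simp
qed

lemma finite_measure_pair:
  assumes "finite_measure M" "finite_measure N"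
  shows "finite_measure (M \<Otimes>\<^sub>M N)"
proof
  interpret M: finite_measure M by fact
  interpret N: finite_measure N by fact
  have "emeasure (M \<Otimes>\<^sub>M N) (space M \<times> space N) = emeasure M (space M) * emeasure N (space N)"
    by (rule N.emeasure_pair_measure_Times) auto
  then show "emeasure (M \<Otimes>\<^sub>M N) (space (M \<Otimes>\<^sub>M N)) \<noteq> \<infinity>"
    by (simp add: space_pair_measure ennreal_mult_eq_top_iff M.emeasure_eq_measure N.emeasure_eq_measure)
qed

lemma measurable_PiM_UNIV:
  assumes "\<And>n. (\<lambda>p. f p n) \<in> L \<rightarrow>\<^sub>M N"
  shows "f \<in> L \<rightarrow>\<^sub>M PiM UNIV (\<lambda>_. N)"
  using measurable_PiM_single'[of UNIV "\<lambda>n p. f p n" L "\<lambda>_. N"] assms measurable_space[OF assms]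
  by (auto simp: PiE_UNIV_domain)

text \<open>Vectors are plain functions on an arbitrary index type, and no topology is asked for:
  the aim is membership of a mean in the cone itself rather than in its closure.\<close>

definition pos_cone :: "('i \<Rightarrow> real) set \<Rightarrow> bool" where
  "pos_cone K \<longleftrightarrow> (\<lambda>_. 0) \<in> K \<and> (\<forall>x\<in>K. \<forall>y\<in>K. \<forall>a\<ge>0. \<forall>b\<ge>0. (\<lambda>i. a * x i + b * y i) \<in> K)"

text \<open>Coordinates are eliminated one at a time, without separating hyperplanes: two vectors at which
  coordinate \<open>a\<close> has opposite signs combine positively into a vector of the cone at which it vanishes,
  and under the product measure these combinations have the same mean as the original vectors. The
  domain consists of sequences because a pair of sequences can be interleaved into a single one, so
  that the type of the domain does not change in the induction.\<close>

lemma integral_in_pos_cone: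
  fixes M :: "(nat \<Rightarrow> 'a) measure" and X :: "(nat \<Rightarrow> 'a) \<Rightarrow> 'i \<Rightarrow> real"
  assumes "finite I" and "finite_measure M" and "sets M = sets (PiM UNIV (\<lambda>_. N))"
    and "pos_cone K" and "\<And>\<omega>. \<omega> \<in> space M \<Longrightarrow> X \<omega> \<in> K"
    and "\<And>i. i \<in> insert r I \<Longrightarrow> integrable M (\<lambda>\<omega>. X \<omega> i)"
    and "\<And>i. i \<in> I \<Longrightarrow> (\<integral>\<omega>. X \<omega> i \<partial>M) = 0"
  shows "\<exists>k\<in>K. (\<forall>i\<in>I. k i = 0) \<and> k r = (\<integral>\<omega>. X \<omega> r \<partial>M)"
  using assms
proof (induction I arbitrary: M X K rule: finite_induct)
  case empty
  \<comment> \<open>With no coordinate left to annihilate, some value of \<open>X\<close> has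
    coordinate \<open>r\<close> of the same sign as the mean \<open>b\<close>, and a positive
    multiple of it attains \<open>b\<close> exactly.\<close>
  define b where "b = (\<integral>\<omega>. X \<omega> r \<partial>M)"
  have sc: "(\<lambda>i. a * x i) \<in> K" if "x \<in> K" "a \<ge> 0" for a x
  proof -
    have "(\<lambda>i. a * x i + 0 * x i) \<in> K"
      using \<open>pos_cone K\<close> that unfolding pos_cone_def by blast
    then show ?thesis by simp
  qed
  consider "b = 0" | "b > 0" | "b < 0" by linarith
  then have "\<exists>k\<in>K. k r = b"
  proof cases
    case 1
    then show ?thesis using \<open>pos_cone K\<close> unfolding pos_cone_def by (auto intro!: bexI[of _ "\<lambda>_. 0"])
  next
    case 2
    have "\<exists>\<omega>\<in>space M. X \<omega> r > 0"
    proof (rule ccontr)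
      assume "\<not> ?thesis"
      then have "0 \<le> (\<integral>\<omega>. - X \<omega> r \<partial>M)"
        by (intro integral_nonneg_AE AE_I2) (force simp: not_less)
      then have "b \<le> 0" unfolding b_def by simp
      with 2 show False by simp
    qed
    then obtain \<omega> where w: "\<omega> \<in> space M" "X \<omega> r > 0" by blast
    have "(\<lambda>i. b / X \<omega> r * X \<omega> i) \<in> K"
      using w 2 by (intro sc empty.prems) auto
    then show ?thesis using w by (intro bexI) auto
  next
    case 3
    have "\<exists>\<omega>\<in>space M. X \<omega> r < 0"
    proof (rule ccontr)
      assume "\<not> ?thesis"
      then have "b \<ge> 0" unfolding b_def by (intro integral_nonneg_AE AE_I2) (force simp: not_less)
      with 3 show False by simp
    qed
    then obtain \<omega> where w: "\<omega> \<in> space M" "X \<omega> r < 0" by blast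
    have "(\<lambda>i. b / X \<omega> r * X \<omega> i) \<in> K"
      using w 3 by (intro sc empty.prems) (auto simp: divide_nonpos_neg)
    then show ?thesis using w by (intro bexI) auto
  qed
  then show ?case unfolding b_def by simp
next
  case (insert a I)
  interpret finite_measure M by fact
  define S :: "(nat \<Rightarrow> 'a) measure" where "S = PiM UNIV (\<lambda>_. N)"
  have sM[measurable_cong]: "sets M = sets S" and spM: "space M = space S"
    using insert.prems(2) sets_eq_imp_space_eq unfolding S_def by auto
  have Xm[measurable]: "i \<in> insert r (insert a I) \<Longrightarrow> (\<lambda>\<omega>. X \<omega> i) \<in> borel_measurable S" for i
    using borel_measurable_integrable[OF insert.prems(5)] measurable_cong_sets[OF sM refl] by blast
  have am[measurable]: "(\<lambda>\<omega>. X \<omega> a) \<in> borel_measurable S" by (rule Xm) simp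
  \<comment> \<open>The induction hypothesis is applied to this subcone, so the vector it returns
    has coordinate \<open>a\<close> equal to zero automatically.\<close>
  define K' where "K' = {k\<in>K. k a = 0}"
  have K': "pos_cone K'" using insert.prems(3) unfolding pos_cone_def K'_def by auto
  have zero: "(\<lambda>_. 0) \<in> K" using insert.prems(3) unfolding pos_cone_def by auto
  \<comment> \<open>\<open>X\<close> is split according to the sign of coordinate \<open>a\<close>;
    values in \<open>P\<close> are to be paired with values in \<open>Q\<close>, while
    \<open>R\<close> already lies in \<open>K'\<close>.\<close>
  define P where "P = (\<lambda>i \<omega>. if X \<omega> a > 0 then X \<omega> i else 0)"
  define Q where "Q = (\<lambda>i \<omega>. if X \<omega> a < 0 then X \<omega> i else 0)"
  define R where "R = (\<lambda>i \<omega>. if X \<omega> a = 0 then X \<omega> i else 0)"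
  have intP: "integrable M (P i)" and intQ: "integrable M (Q i)" and intR: "integrable M (R i)"
    if i: "i \<in> insert r (insert a I)" for i
  proof -
    note [measurable] = Xm[OF i]
    show "integrable M (P i)" unfolding P_def
      by (rule Bochner_Integration.integrable_bound[OF insert.prems(5)[OF i]]) auto
    show "integrable M (Q i)" unfolding Q_def
      by (rule Bochner_Integration.integrable_bound[OF insert.prems(5)[OF i]]) auto
    show "integrable M (R i)" unfolding R_def
      by (rule Bochner_Integration.integrable_bound[OF insert.prems(5)[OF i]]) auto
  qed
  have PQR: "(\<integral>\<omega>. X \<omega> i \<partial>M) = (\<integral>\<omega>. P i \<omega> \<partial>M) + (\<integral>\<omega>. Q i \<omega> \<partial>M) + (\<integral>\<omega>. R i \<omega> \<partial>M)"
    if i: "i \<in> insert r (insert a I)" for i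
  proof -
    have "(\<integral>\<omega>. X \<omega> i \<partial>M) = (\<integral>\<omega>. P i \<omega> + Q i \<omega> + R i \<omega> \<partial>M)"
      by (rule Bochner_Integration.integral_cong) (auto simp: P_def Q_def R_def)
    also have "\<dots> = (\<integral>\<omega>. P i \<omega> \<partial>M) + (\<integral>\<omega>. Q i \<omega> \<partial>M) + (\<integral>\<omega>. R i \<omega> \<partial>M)"
      using intP[OF i] intQ[OF i] intR[OF i] by simp
    finally show ?thesis .
  qed
  \<comment> \<open>Coordinate \<open>a\<close> has mean zero, so its negative part has integral
    \<open>- c\<close>. This balance is what makes the pairing below preserve means.\<close>
  define c where "c = (\<integral>\<omega>. P a \<omega> \<partial>M)"
  have "(\<integral>\<omega>. R a \<omega> \<partial>M) = (\<integral>\<omega>. 0 \<partial>M)"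
    by (rule Bochner_Integration.integral_cong) (auto simp: R_def)
  then have cQ: "(\<integral>\<omega>. Q a \<omega> \<partial>M) = - c"
    using PQR[of a] insert.prems(6)[of a] unfolding c_def by simp
  have c0: "c \<ge> 0" unfolding c_def by (rule integral_nonneg_AE) (auto simp: P_def)
  show ?case
  proof (cases "c = 0")
    case True
    \<comment> \<open>Here coordinate \<open>a\<close> vanishes almost everywhere, so putting 0
      where it does not changes no mean and brings every value into \<open>K'\<close>.\<close>
    have "AE \<omega> in M. P a \<omega> = 0"
      using integral_nonneg_eq_0_iff_AE[OF intP[of a]] True unfolding c_def by (auto simp: P_def)
    moreover have "AE \<omega> in M. Q a \<omega> = 0"
    proof -
      have "(\<integral>\<omega>. - Q a \<omega> \<partial>M) = 0" using cQ True by simp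
      then show ?thesis
        using integral_nonneg_eq_0_iff_AE[of M "\<lambda>\<omega>. - Q a \<omega>"] intQ[of a] by (auto simp: Q_def)
    qed
    ultimately have ae: "AE \<omega> in M. X \<omega> a = 0"
      by eventually_elim (auto simp: P_def Q_def split: if_splits)
    have eq: "(\<integral>\<omega>. R i \<omega> \<partial>M) = (\<integral>\<omega>. X \<omega> i \<partial>M)" if "i \<in> insert r (insert a I)" for i
      using ae by (intro integral_cong_AE borel_measurable_integrable[OF intR[OF that]]
          borel_measurable_integrable[OF insert.prems(5)[OF that]]) (auto simp: R_def)
    have "\<exists>k\<in>K'. (\<forall>i\<in>I. k i = 0) \<and> k r = (\<integral>\<omega>. R r \<omega> \<partial>M)"
    proof (rule insert.IH[where X="\<lambda>\<omega> i. R i \<omega>", OF _ insert.prems(2) K'])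
      show "finite_measure M" by fact
      show "(\<lambda>i. R i \<omega>) \<in> K'" if "\<omega> \<in> space M" for \<omega>
        using insert.prems(4)[OF that] zero by (cases "X \<omega> a = 0") (auto simp: R_def K'_def)
    qed (use intR eq insert.prems(6) in auto)
    then show ?thesis using eq[of r] unfolding K'_def by auto
  next
    case False
    \<comment> \<open>The total mass compensates for integrating the \<open>R\<close> part, which
      depends on one variable only, over the second factor of the product.\<close>
    define m where "m = measure M (space M)"
    have "m \<noteq> 0"
    proof
      assume "m = 0"
      then have "AE \<omega> in M. P a \<omega> = 0"
        by (intro AE_I[of _ _ "space M"]) (auto simp: m_def emeasure_eq_measure)
      then have "c = (\<integral>\<omega>. 0 \<partial>M)" unfolding c_def
        by (intro integral_cong_AE) (use borel_measurable_integrable[OF intP[of a]] in auto)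
      with False show False by simp
    qed
    then have m0: "m > 0" unfolding m_def using measure_nonneg[of M "space M"] by linarith
    \<comment> \<open>Even positions carry the first sequence and odd positions the second, so the
      image of the product measure is again a measure on sequences over \<open>N\<close>.\<close>
    define \<iota> :: "(nat \<Rightarrow> 'a) \<times> (nat \<Rightarrow> 'a) \<Rightarrow> nat \<Rightarrow> 'a"
      where "\<iota> = (\<lambda>p n. if even n then fst p (n div 2) else snd p (n div 2))"
    define \<pi>1 :: "(nat \<Rightarrow> 'a) \<Rightarrow> nat \<Rightarrow> 'a" where "\<pi>1 = (\<lambda>\<omega> n. \<omega> (2 * n))"
    define \<pi>2 :: "(nat \<Rightarrow> 'a) \<Rightarrow> nat \<Rightarrow> 'a" where "\<pi>2 = (\<lambda>\<omega> n. \<omega> (2 * n + 1))"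
    have \<pi>\<iota>: "\<pi>1 (\<iota> p) = fst p" "\<pi>2 (\<iota> p) = snd p" for p
      by (auto simp: \<pi>1_def \<pi>2_def \<iota>_def)
    have [measurable]: "(\<lambda>\<omega>. \<omega> n) \<in> S \<rightarrow>\<^sub>M N" for n
      unfolding S_def by (rule measurable_component_singleton) simp
    have [measurable]: "\<iota> \<in> S \<Otimes>\<^sub>M S \<rightarrow>\<^sub>M S"
    proof -
      have "(\<lambda>p. \<iota> p n) \<in> S \<Otimes>\<^sub>M S \<rightarrow>\<^sub>M N" for n unfolding \<iota>_def by (cases "even n") simp_all
      then show ?thesis using measurable_PiM_UNIV unfolding S_def by blast
    qed
    have [measurable]: "\<pi>1 \<in> S \<rightarrow>\<^sub>M S" "\<pi>2 \<in> S \<rightarrow>\<^sub>M S"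
    proof -
      have "(\<lambda>p. \<pi>1 p n) \<in> S \<rightarrow>\<^sub>M N" "(\<lambda>p. \<pi>2 p n) \<in> S \<rightarrow>\<^sub>M N" for n
        unfolding \<pi>1_def \<pi>2_def by simp_all
      then show "\<pi>1 \<in> S \<rightarrow>\<^sub>M S" "\<pi>2 \<in> S \<rightarrow>\<^sub>M S"
        using measurable_PiM_UNIV unfolding S_def by blast+
    qed
    define M' where "M' = distr (M \<Otimes>\<^sub>M M) S \<iota>"
    have MS[measurable_cong]: "sets (M \<Otimes>\<^sub>M M) = sets (S \<Otimes>\<^sub>M S)" by (intro sets_pair_measure_cong sM)
    interpret MM: finite_measure "M \<Otimes>\<^sub>M M" by (rule finite_measure_pair) fact+
    have fM': "finite_measure M'" unfolding M'_def by (rule MM.finite_measure_distr) simp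
    have sM'[measurable_cong]: "sets M' = sets S" and spM': "space M' = space S"
      unfolding M'_def by simp_all
    \<comment> \<open>Weighting each vector by the size of the other's coordinate \<open>a\<close>
      cancels that coordinate. The weights integrate to \<open>c\<close>, so after division by
      \<open>c\<close> the means of \<open>P i\<close> and \<open>Q i\<close> reappear; the factor
      \<open>1 / m\<close> does the same for \<open>R i\<close>.\<close>
    define T where "T = (\<lambda>i p. (P i (fst p) * - Q a (snd p) + P a (fst p) * Q i (snd p)) / c
        + R i (fst p) * (1 / m))"
    define X' where "X' = (\<lambda>\<omega> i. T i (\<pi>1 \<omega>, \<pi>2 \<omega>))"
    have X'\<iota>: "X' (\<iota> p) i = T i p" for p i unfolding X'_def \<pi>\<iota> by simp
    have Tint: "integrable (M \<Otimes>\<^sub>M M) (T i)" "(\<integral>p. T i p \<partial>(M \<Otimes>\<^sub>M M)) = (\<integral>\<omega>. X \<omega> i \<partial>M)"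
      if i: "i \<in> insert r (insert a I)" for i
    proof -
      note fm = \<open>finite_measure M\<close> \<open>finite_measure M\<close>
      have "integrable M (\<lambda>\<omega>. - Q a \<omega>)" using intQ[of a] by simp
      note 1 = integrable_mult_pair[OF fm intP[OF i] this]
      note 2 = integrable_mult_pair[OF fm intP[of a] intQ[OF i]]
      note 3 = integrable_mult_pair[OF fm intR[OF i], of "\<lambda>_. 1 / m"]
      show "integrable (M \<Otimes>\<^sub>M M) (T i)"
        unfolding T_def using 1(1) 2(1) 3(1) by simp
      have "(\<integral>p. T i p \<partial>(M \<Otimes>\<^sub>M M)) = ((\<integral>\<omega>. P i \<omega> \<partial>M) * c + c * (\<integral>\<omega>. Q i \<omega> \<partial>M)) / c
          + (\<integral>\<omega>. R i \<omega> \<partial>M) * (m * (1 / m))"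
        unfolding T_def using 1 2 3 cQ by (simp add: c_def[symmetric] m_def[symmetric])
      also have "\<dots> = (\<integral>\<omega>. X \<omega> i \<partial>M)"
        unfolding PQR[OF i] using False m0 by (simp add: field_simps)
      finally show "(\<integral>p. T i p \<partial>(M \<Otimes>\<^sub>M M)) = (\<integral>\<omega>. X \<omega> i \<partial>M)" .
    qed
    have X'm: "(\<lambda>\<omega>. X' \<omega> i) \<in> borel_measurable S" if i: "i \<in> insert r (insert a I)" for i
    proof -
      note [measurable] = Xm[OF i]
      show ?thesis unfolding X'_def T_def P_def Q_def R_def by simp
    qed
    have X'int: "integrable M' (\<lambda>\<omega>. X' \<omega> i)" "(\<integral>\<omega>. X' \<omega> i \<partial>M') = (\<integral>\<omega>. X \<omega> i \<partial>M)"
      if i: "i \<in> insert r (insert a I)" for i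
    proof -
      show "integrable M' (\<lambda>\<omega>. X' \<omega> i)"
        unfolding M'_def using X'm[OF i] Tint(1)[OF i] by (subst integrable_distr_eq) (auto simp: X'\<iota>)
      show "(\<integral>\<omega>. X' \<omega> i \<partial>M') = (\<integral>\<omega>. X \<omega> i \<partial>M)"
        unfolding M'_def using X'm[OF i] Tint(2)[OF i] by (subst integral_distr) (auto simp: X'\<iota>)
    qed
    have "\<exists>k\<in>K'. (\<forall>i\<in>I. k i = 0) \<and> k r = (\<integral>\<omega>. X' \<omega> r \<partial>M')"
    proof (rule insert.IH[OF fM' _ K'])
      show "sets M' = sets (PiM UNIV (\<lambda>_. N))" using sM' S_def by simp
      show "X' \<omega> \<in> K'" if "\<omega> \<in> space M'" for \<omega>
      proof -
        have "\<pi>1 \<omega> \<in> space M" "\<pi>2 \<omega> \<in> space M"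
          using that unfolding spM' spM by (auto intro: measurable_space)
        then have *: "X (\<pi>1 \<omega>) \<in> K" "X (\<pi>2 \<omega>) \<in> K" using insert.prems(4) by auto
        have comb: "(\<lambda>i. s * X (\<pi>1 \<omega>) i + t * X (\<pi>2 \<omega>) i) \<in> K" if "s \<ge> 0" "t \<ge> 0" for s t
          using insert.prems(3) * that unfolding pos_cone_def by blast
        show ?thesis
        \<comment> \<open>Only one part of \<open>T\<close> survives at a time: the combination for
          a positive first and negative second coordinate \<open>a\<close>, the \<open>R\<close>
          term when the first is zero, and nothing otherwise.\<close>
        proof (cases "X (\<pi>1 \<omega>) a > 0 \<and> X (\<pi>2 \<omega>) a < 0")
          case True
          then have "X' \<omega> = (\<lambda>i. (- X (\<pi>2 \<omega>) a / c) * X (\<pi>1 \<omega>) i + (X (\<pi>1 \<omega>) a / c) * X (\<pi>2 \<omega>) i)"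
            by (auto simp: X'_def T_def P_def Q_def R_def add_divide_distrib diff_divide_distrib mult.commute)
          moreover have "\<dots> \<in> K" using True c0 by (intro comb) (auto simp: divide_nonpos_nonneg)
          moreover have "X' \<omega> a = 0" unfolding calculation(1) by simp
          ultimately show ?thesis unfolding K'_def by simp
        next
          case F: False
          show ?thesis
          proof (cases "X (\<pi>1 \<omega>) a = 0")
            case True
            then have "X' \<omega> = (\<lambda>i. (1 / m) * X (\<pi>1 \<omega>) i + 0 * X (\<pi>2 \<omega>) i)"
              by (auto simp: X'_def T_def P_def Q_def R_def add_divide_distrib diff_divide_distrib mult.commute)
            moreover have "\<dots> \<in> K" using m0 by (intro comb) auto
            moreover have "X' \<omega> a = 0" unfolding calculation(1) using True by simp
            ultimately show ?thesis unfolding K'_def by simp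
          next
            case False
            then have "X' \<omega> = (\<lambda>_. 0)" using F
              by (auto simp: X'_def T_def P_def Q_def R_def add_divide_distrib diff_divide_distrib mult.commute)
            then show ?thesis using zero unfolding K'_def by simp
          qed
        qed
      qed
      show "integrable M' (\<lambda>\<omega>. X' \<omega> i)" if "i \<in> insert r I" for i
        using that X'int(1) by auto
      show "(\<integral>\<omega>. X' \<omega> i \<partial>M') = 0" if "i \<in> I" for i
        using that X'int(2) insert.prems(6) by auto
    qed
    then show ?thesis using X'int(2)[of r] unfolding K'_def by auto
  qed
qed

text \<open>The vectors of values of the functions at points of \<open>S\<close> generate a cone of
  finite positive combinations. Since \<open>integral_in_pos_cone\<close> places the vector of
  integrals in this cone, the combination it comes from is the set of atoms and weights.\<close>

theorem Tchakaloff: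
  fixes M :: "'a measure" and f :: "'i \<Rightarrow> 'a \<Rightarrow> real"
  assumes "finite_measure M" and S: "S \<in> sets M" "AE x in M. x \<in> S"
    and "finite I" and f: "\<And>i. i \<in> I \<Longrightarrow> integrable M (f i)"
  shows "\<exists>A c. finite A \<and> A \<subseteq> S \<and> (\<forall>x. c x \<ge> 0) \<and>
           (\<forall>i\<in>I. (\<Sum>x\<in>A. c x * f i x) = (\<integral>x. f i x \<partial>M))"
\<comment> \<open>The null measure is treated apart, because the means below are quotients by the
  total mass.\<close>
proof (cases "measure M (space M) = 0")
  case True
  interpret finite_measure M by fact
  have "(\<integral>x. f i x \<partial>M) = (\<integral>x. 0 \<partial>M)" if "i \<in> I" for i
  proof (rule integral_cong_AE)
    show "AE x in M. f i x = 0"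
      using True by (intro AE_I[of _ _ "space M"]) (auto simp: emeasure_eq_measure)
  qed (use f[OF that] in auto)
  then show ?thesis by (intro exI[of _ "{}"] exI[of _ "\<lambda>_. 0"]) auto
next
  case False
  interpret finite_measure M by fact
  define m where "m = measure M (space M)"
  have m: "m \<noteq> 0" using False m_def by simp
  \<comment> \<open>Subtracting the means costs one coordinate, \<open>None\<close>, which keeps track of the total mass.\<close>
  define g :: "'i option \<Rightarrow> 'a \<Rightarrow> real" where
    "g = (\<lambda>i x. case i of None \<Rightarrow> 1 | Some i \<Rightarrow> f i x - (\<integral>x. f i x \<partial>M) / m)"
  define K where "K = {k. \<exists>A c. finite A \<and> A \<subseteq> S \<and> (\<forall>x. c x \<ge> 0) \<and> k = (\<lambda>i. \<Sum>x\<in>A. c x * g i x)}"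
  have K: "pos_cone K" unfolding pos_cone_def
  proof (intro conjI ballI allI impI)
    show "(\<lambda>_. 0) \<in> K" unfolding K_def by (auto intro!: exI[of _ "{}"] exI[of _ "\<lambda>_. 0"])
    fix y z and a b :: real assume "y \<in> K" "z \<in> K" and ab: "a \<ge> 0" "b \<ge> 0"
    then obtain A c B d where A: "finite A" "A \<subseteq> S" "\<forall>x. c x \<ge> 0" "y = (\<lambda>i. \<Sum>x\<in>A. c x * g i x)"
      and B: "finite B" "B \<subseteq> S" "\<forall>x. d x \<ge> 0" "z = (\<lambda>i. \<Sum>x\<in>B. d x * g i x)"
      unfolding K_def by blast
    \<comment> \<open>The two sets of atoms may overlap, so both weights are extended by zero and
      added on the union.\<close>
    define e where "e = (\<lambda>x. a * (if x \<in> A then c x else 0) + b * (if x \<in> B then d x else 0))"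
    have "a * y i + b * z i = (\<Sum>x\<in>A \<union> B. e x * g i x)" for i
    proof -
      have "a * y i = (\<Sum>x\<in>A \<union> B. a * (if x \<in> A then c x else 0) * g i x)"
        unfolding A(4) sum_distrib_left using A(1) B(1) by (intro sum.mono_neutral_cong_left) auto
      moreover have "b * z i = (\<Sum>x\<in>A \<union> B. b * (if x \<in> B then d x else 0) * g i x)"
        unfolding B(4) sum_distrib_left using A(1) B(1) by (intro sum.mono_neutral_cong_left) auto
      ultimately show ?thesis unfolding e_def by (simp add: sum.distrib distrib_right)
    qed
    moreover have "\<forall>x. e x \<ge> 0" using A(3) B(3) ab unfolding e_def by auto
    ultimately show "(\<lambda>i. a * y i + b * z i) \<in> K"
      unfolding K_def using A(1,2) B(1,2) by (auto intro!: exI[of _ "A \<union> B"] exI[of _ e])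
  qed
  \<comment> \<open>\<open>integral_in_pos_cone\<close> needs a measure on sequences: points are
    embedded as constant sequences and recovered as entry 0.\<close>
  define P :: "(nat \<Rightarrow> 'a) measure" where "P = PiM UNIV (\<lambda>_. M)"
  define D where "D = distr M P (\<lambda>x _. x)"
  have cm[measurable]: "(\<lambda>x _. x) \<in> M \<rightarrow>\<^sub>M P" unfolding P_def by (rule measurable_PiM_UNIV) simp
  have em[measurable]: "(\<lambda>\<omega>. \<omega> 0) \<in> P \<rightarrow>\<^sub>M M"
    unfolding P_def by (rule measurable_component_singleton) simp
  \<comment> \<open>Cutting off outside \<open>S\<close> gives the value 0, which is in
    \<open>K\<close>; thus membership holds at every point and not just almost everywhere.\<close>
  define h where "h = (\<lambda>i x. indicator S x * g i x)"
  have gint: "integrable M (g i)" "(\<integral>x. g i x \<partial>M) = (if i = None then m else 0)"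
    if "i \<in> insert None (Some ` I)" for i
    using that f m unfolding g_def by (auto simp: m_def)
  have hint: "integrable M (h i)" "(\<integral>x. h i x \<partial>M) = (if i = None then m else 0)"
    if i: "i \<in> insert None (Some ` I)" for i
  proof -
    show int: "integrable M (h i)" unfolding h_def
      using integrable_real_mult_indicator[OF S(1) gint(1)[OF i]] by (simp add: mult.commute)
    have "(\<integral>x. h i x \<partial>M) = (\<integral>x. g i x \<partial>M)"
      by (rule integral_cong_AE) (use int gint(1)[OF i] S(2) in \<open>auto simp: h_def\<close>)
    then show "(\<integral>x. h i x \<partial>M) = (if i = None then m else 0)" using gint(2)[OF i] by simp
  qed
  have "\<exists>k\<in>K. (\<forall>i\<in>Some ` I. k i = 0) \<and> k None = (\<integral>\<omega>. h None (\<omega> 0) \<partial>D)"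
  proof (rule integral_in_pos_cone[where X="\<lambda>\<omega> i. h i (\<omega> 0)" and N=M, OF _ _ _ K])
    show "finite (Some ` I)" using \<open>finite I\<close> by simp
    show "finite_measure D" unfolding D_def by (rule finite_measure_distr) simp
    show "sets D = sets (PiM UNIV (\<lambda>_. M))" unfolding D_def P_def by simp
    show "(\<lambda>i. h i (\<omega> 0)) \<in> K" if "\<omega> \<in> space D" for \<omega>
    proof (cases "\<omega> 0 \<in> S")
      case True
      then show ?thesis unfolding K_def h_def
        by (auto intro!: exI[of _ "{\<omega> 0}"] exI[of _ "\<lambda>_. 1"])
    next
      case False
      then show ?thesis using K unfolding h_def pos_cone_def by simp
    qed
    fix i assume i: "i \<in> insert None (Some ` I)"
    show "integrable D (\<lambda>\<omega>. h i (\<omega> 0))"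
      unfolding D_def using hint(1)[OF i] by (subst integrable_distr_eq) auto
  next
    fix i assume "i \<in> Some ` I"
    then show "(\<integral>\<omega>. h i (\<omega> 0) \<partial>D) = 0"
      unfolding D_def using hint[of i] by (subst integral_distr) auto
  qed
  moreover have "(\<integral>\<omega>. h None (\<omega> 0) \<partial>D) = m"
    unfolding D_def using hint[of None] by (subst integral_distr) auto
  ultimately obtain A c where A: "finite A" "A \<subseteq> S" "\<forall>x. c x \<ge> 0"
    and z: "\<forall>i\<in>I. (\<Sum>x\<in>A. c x * g (Some i) x) = 0" and tot: "(\<Sum>x\<in>A. c x * g None x) = m"
    unfolding K_def by auto
  have "(\<Sum>x\<in>A. c x * f i x) = (\<integral>x. f i x \<partial>M)" if "i \<in> I" for i
  proof -
    \<comment> \<open>By \<open>tot\<close> the weights sum to \<open>m\<close>, so the subtracted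
      means add up to the full integral.\<close>
    have "(\<Sum>x\<in>A. c x * f i x) = (\<Sum>x\<in>A. c x * g (Some i) x) + (\<Sum>x\<in>A. c x * ((\<integral>x. f i x \<partial>M) / m))"
      by (simp add: g_def sum.distrib[symmetric] algebra_simps)
    also have "\<dots> = (\<Sum>x\<in>A. c x * g None x) * ((\<integral>x. f i x \<partial>M) / m)"
      using z that unfolding sum_distrib_right by (simp add: g_def)
    finally show ?thesis using m tot by simp
  qed
  then show ?thesis using A by blast
qed

section \<open>Convergence of moments implies convergence of Laplace transforms\<close>

text \<open>On the closed left half plane the exponential is bounded by 1, so the Taylor remainder
  carries no exponential factor.\<close>

lemma exp_uminus_Taylor:
  assumes "Re z \<ge> 0"
  shows "norm (exp (- z) - (\<Sum>i\<le>n. (- z) ^ i / fact i)) \<le> norm z ^ Suc n / fact n"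
proof -
  have "norm (exp (- z) - (\<Sum>i\<le>n. exp 0 * (- z - 0) ^ i / fact i)) \<le> 1 * norm (- z - 0) ^ Suc n / fact n"
  proof (rule complex_Taylor[where S="{w. Re w \<le> 0}" and f="\<lambda>_. exp"])
    show "convex {w. Re w \<le> 0}" by (rule convex_halfspace_Re_le)
    show "(exp has_field_derivative exp x) (at x within {w. Re w \<le> 0})" for x :: complex
      by (rule DERIV_exp[THEN has_field_derivative_at_within])
  qed (use assms in auto)
  then show ?thesis by simp
qed

lemma norm_power_mult_exp_le:
  assumes "Re z \<ge> 0" "norm z \<le> w" "t \<ge> 0"
  shows "norm (z ^ k * exp (- (of_real t * z))) \<le> w ^ k"
proof -
  have "norm (z ^ k * exp (- (of_real t * z))) = norm z ^ k * exp (- (t * Re z))"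
    by (simp add: norm_mult norm_power)
  also have "\<dots> \<le> w ^ k * 1"
    using assms order_trans[OF norm_ge_zero assms(2)] by (intro mult_mono power_mono) auto
  finally show ?thesis by simp
qed

text \<open>Expand the factor \<open>exp (- h * b x)\<close> to order \<open>N\<close>. The
  remaining exponential has modulus at most 1, so the error is bounded by a pure moment of
  \<open>w\<close>, regardless of how large \<open>t\<close> is.\<close>

lemma exp_moment_step:
  fixes b :: "'a \<Rightarrow> complex"
  assumes b[measurable]: "b \<in> borel_measurable M"
    and ae: "AE x in M. Re (b x) \<ge> 0 \<and> norm (b x) \<le> w x"
    and w: "\<And>j. integrable M (\<lambda>x. w x ^ j)"
    and t: "t \<ge> 0" and h: "h \<ge> 0"
  shows "norm ((\<integral>x. b x ^ k * exp (- (of_real (t + h) * b x)) \<partial>M)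
      - (\<Sum>j\<le>N. of_real ((- h) ^ j / fact j) * (\<integral>x. b x ^ (k + j) * exp (- (of_real t * b x)) \<partial>M)))
    \<le> h ^ Suc N / fact N * (\<integral>x. w x ^ (k + Suc N) \<partial>M)"
proof -
  have int: "integrable M (\<lambda>x. b x ^ k * exp (- (of_real s * b x)))" if "s \<ge> 0" for s k
  proof (rule Bochner_Integration.integrable_bound[OF w[of k]])
    show "AE x in M. norm (b x ^ k * exp (- (of_real s * b x))) \<le> norm (w x ^ k)"
      using ae
    proof eventually_elim
      case (elim x)
      then show ?case using norm_power_mult_exp_le[of "b x" "w x" s k] that
        by (smt (verit) norm_ge_zero real_norm_def)
    qed
  qed simp
  let ?T = "\<lambda>x. \<Sum>j\<le>N. of_real ((- h) ^ j / fact j) * (b x ^ (k + j) * exp (- (of_real t * b x)))"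
  have "(\<integral>x. b x ^ k * exp (- (of_real (t + h) * b x)) \<partial>M)
      - (\<Sum>j\<le>N. of_real ((- h) ^ j / fact j) * (\<integral>x. b x ^ (k + j) * exp (- (of_real t * b x)) \<partial>M))
    = (\<integral>x. b x ^ k * exp (- (of_real (t + h) * b x)) - ?T x \<partial>M)"
    using int t h by (subst Bochner_Integration.integral_diff) (auto simp del: of_real_add)
  also have "norm \<dots> \<le> (\<integral>x. h ^ Suc N / fact N * w x ^ (k + Suc N) \<partial>M)"
  proof (rule order_trans[OF integral_norm_bound integral_mono_AE])
    show "integrable M (\<lambda>x. norm (b x ^ k * exp (- (of_real (t + h) * b x)) - ?T x))"
      using int t h by (intro integrable_norm Bochner_Integration.integrable_diff Bochner_Integration.integrable_sum) (auto simp del: of_real_add)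
    show "integrable M (\<lambda>x. h ^ Suc N / fact N * w x ^ (k + Suc N))"
      by (rule integrable_mult_right[OF w])
    show "AE x in M. norm (b x ^ k * exp (- (of_real (t + h) * b x)) - ?T x)
        \<le> h ^ Suc N / fact N * w x ^ (k + Suc N)"
      using ae
    proof eventually_elim
      case (elim x)
      have "?T x = (b x ^ k * exp (- (of_real t * b x))) * (\<Sum>j\<le>N. (- (of_real h * b x)) ^ j / fact j)"
        unfolding sum_distrib_left by (intro sum.cong refl) (simp add: power_add power_minus' power_mult_distrib)
      moreover have "exp (- (of_real (t + h) * b x)) = exp (- (of_real t * b x)) * exp (- (of_real h * b x))"
        by (simp add: exp_add[symmetric] algebra_simps)
      ultimately have "b x ^ k * exp (- (of_real (t + h) * b x)) - ?T x = (b x ^ k * exp (- (of_real t * b x)))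
          * (exp (- (of_real h * b x)) - (\<Sum>j\<le>N. (- (of_real h * b x)) ^ j / fact j))"
        by (simp only: right_diff_distrib mult.assoc)
      also have "norm \<dots> \<le> w x ^ k * (norm (of_real h * b x) ^ Suc N / fact N)"
        unfolding norm_mult[of "b x ^ k * exp (- (of_real t * b x))"]
        using elim t h order_trans[OF norm_ge_zero, of "b x" "w x"]
        by (intro mult_mono norm_power_mult_exp_le exp_uminus_Taylor) auto
      also have "\<dots> \<le> w x ^ k * ((h * w x) ^ Suc N / fact N)"
        using elim h order_trans[OF norm_ge_zero, of "b x" "w x"]
        by (intro mult_left_mono divide_right_mono power_mono) (auto simp: norm_mult mult_left_mono)
      also have "\<dots> = h ^ Suc N / fact N * w x ^ (k + Suc N)"
        by (simp add: power_add power_mult_distrib)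
      finally show ?case .
    qed
  qed
  finally show ?thesis by simp
qed

text \<open>A binomial coefficient is at most a power of 2; this separates the fixed moment order
  from the growing Taylor order at geometric cost.\<close>

lemma fact_add_le: "(fact (k + n) :: real) \<le> fact k * fact n * 2 ^ (k + n)"
proof -
  have "fact k * fact n * ((k + n) choose k) = (fact (k + n) :: nat)"
    using binomial_fact_lemma[of k "k + n"] by simp
  then have "(fact (k + n) :: nat) \<le> fact k * fact n * 2 ^ (k + n)"
    using binomial_le_pow2[of "k + n" k] by (metis mult_le_mono2)
  then have "real (fact (k + n)) \<le> real (fact k * fact n * 2 ^ (k + n))" by (rule of_nat_mono)
  then show ?thesis by simp
qed

lemma uniform_limit_sum:
  fixes f :: "'i \<Rightarrow> 'n \<Rightarrow> 'b \<Rightarrow> 'c::real_normed_vector"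
  assumes "\<And>j. j \<in> J \<Longrightarrow> uniform_limit S (f j) (l j) F"
  shows "uniform_limit S (\<lambda>n x. \<Sum>j\<in>J. f j n x) (\<lambda>x. \<Sum>j\<in>J. l j x) F"
  using assms by (induction J rule: infinite_finite_induct) (auto intro!: uniform_limit_intros)

text \<open>Uniformity in \<beta> comes from the majorants, which do not depend on \<beta>. By
  \<open>w_eq\<close> their moments agree for large \<open>n\<close>, so one remainder estimate
  serves the limit and the approximants alike.\<close>

lemma uniform_limit_exp_moments:
  fixes b :: "'b \<Rightarrow> 'a \<Rightarrow> complex" and b' :: "nat \<Rightarrow> 'b \<Rightarrow> 'c \<Rightarrow> complex" and N :: "nat \<Rightarrow> 'c measure"
  assumes bM: "\<And>\<beta>. \<beta> \<in> S \<Longrightarrow> b \<beta> \<in> borel_measurable M"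
    and bN: "\<And>\<beta> n. \<beta> \<in> S \<Longrightarrow> b' n \<beta> \<in> borel_measurable (N n)"
    and aeM: "\<And>\<beta>. \<beta> \<in> S \<Longrightarrow> AE x in M. Re (b \<beta> x) \<ge> 0 \<and> norm (b \<beta> x) \<le> w x"
    and aeN: "\<And>\<beta> n. \<beta> \<in> S \<Longrightarrow> AE x in N n. Re (b' n \<beta> x) \<ge> 0 \<and> norm (b' n \<beta> x) \<le> w' n x"
    and wM: "\<And>j. integrable M (\<lambda>x. w x ^ j)" and wN: "\<And>j n. integrable (N n) (\<lambda>x. w' n x ^ j)"
    and w_eq: "\<And>j n. j \<le> 2 * n + 1 \<Longrightarrow> (\<integral>x. w' n x ^ j \<partial>N n) = (\<integral>x. w x ^ j \<partial>M)"
    and b_eq: "\<And>\<beta> j n. \<beta> \<in> S \<Longrightarrow> j \<le> 2 * n + 1 \<Longrightarrow>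
      (\<integral>x. b' n \<beta> x ^ j \<partial>N n) = (\<integral>x. b \<beta> x ^ j \<partial>M)"
    and growth: "\<And>j. (\<integral>x. w x ^ j \<partial>M) \<le> B * \<sigma> ^ j * fact j" and "\<sigma> > 0"
  shows "uniform_limit S (\<lambda>n \<beta>. \<integral>x. exp (- b' n \<beta> x) \<partial>N n) (\<lambda>\<beta>. \<integral>x. exp (- b \<beta> x) \<partial>M) sequentially"
proof -
  define E where "E = (\<lambda>k t \<beta>. \<integral>x. b \<beta> x ^ k * exp (- (complex_of_real t * b \<beta> x)) \<partial>M)"
  define E' where "E' = (\<lambda>n k t \<beta>. \<integral>x. b' n \<beta> x ^ k * exp (- (complex_of_real t * b' n \<beta> x)) \<partial>N n)"
  \<comment> \<open>With \<open>h = 1 / L\<close>, exactly \<open>L\<close> steps lead from 0 to 1,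
    and \<open>h * \<sigma> \<le> 1 / 4\<close> leaves a ratio 1/2 after the factor 2 lost in
    \<open>fact_add_le\<close>.\<close>
  obtain L :: nat where L: "L > 0" "4 * \<sigma> \<le> real L"
    using reals_Archimedean2[of "4 * \<sigma>"] \<open>\<sigma> > 0\<close> by (metis less_eq_real_def of_nat_0_less_iff order_less_trans mult_pos_pos zero_less_numeral)
  define h where "h = 1 / real L"
  have h: "h > 0" "h * \<sigma> \<le> 1 / 4" using L unfolding h_def by (auto simp: field_simps)
  \<comment> \<open>All orders \<open>k\<close> are treated together, since a step at order
    \<open>k\<close> uses higher orders at the previous time. At time 0 the moments are equal as
    soon as \<open>n \<ge> k\<close>.\<close>
  have main: "uniform_limit S (\<lambda>n. E' n k (real i * h)) (E k (real i * h)) sequentially" for i k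
  proof (induction i arbitrary: k)
    case 0
    show ?case
    proof (rule uniform_limitI)
      fix e :: real assume "e > 0"
      show "\<forall>\<^sub>F n in sequentially. \<forall>x\<in>S. dist (E' n k (real 0 * h) x) (E k (real 0 * h) x) < e"
        using eventually_ge_at_top[of k]
        by eventually_elim (auto simp: E_def E'_def b_eq \<open>e > 0\<close>)
    qed
  next
    case (Suc i)
    let ?t = "real i * h"
    have t: "real (Suc i) * h = ?t + h" "?t \<ge> 0" using h by (auto simp: algebra_simps)
    show ?case unfolding t(1)
    proof (rule uniform_limitI)
      fix e :: real assume e: "e > 0"
      \<comment> \<open>These are the factors of the remainder bound that do not depend on the
        Taylor order \<open>q\<close>. Splitting \<open>k + Suc q\<close> as
        \<open>Suc k + q\<close> lets the factorial of \<open>q\<close> cancel; the absolute value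
        is there because \<open>B\<close> has no assumed sign.\<close>
      define C where "C = \<bar>B\<bar> * \<sigma> ^ k * fact (Suc k) * 2 ^ k"
      have "(\<lambda>q. C * (1/2) ^ Suc q) \<longlonglongrightarrow> C * 0"
        by (intro tendsto_mult tendsto_const LIMSEQ_Suc LIMSEQ_power_zero) simp
      then have "\<forall>\<^sub>F q in sequentially. C * (1/2) ^ Suc q < e / 3"
        by (rule order_tendstoD) (use e in auto)
      then obtain q where q: "C * (1/2) ^ Suc q < e / 3" by (auto simp: eventually_sequentially)
      let ?T = "\<lambda>E \<beta>. \<Sum>j\<le>q. of_real ((- h) ^ j / fact j) * E (k + j) ?t \<beta>"
      have bound: "h ^ Suc q / fact q * (\<integral>x. w x ^ (k + Suc q) \<partial>M) < e / 3"
      proof -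
        have "h ^ Suc q / fact q * (\<integral>x. w x ^ (k + Suc q) \<partial>M)
            \<le> h ^ Suc q / fact q * (\<bar>B\<bar> * \<sigma> ^ (k + Suc q) * fact (k + Suc q))"
          using growth[of "k + Suc q"] h \<open>\<sigma> > 0\<close>
          by (intro mult_left_mono) (auto intro: order_trans mult_right_mono simp: mult.assoc)
        also have "\<dots> \<le> h ^ Suc q / fact q * (\<bar>B\<bar> * \<sigma> ^ (k + Suc q) * (fact (Suc k) * fact q * 2 ^ (k + Suc q)))"
          using fact_add_le[of "Suc k" q] h \<open>\<sigma> > 0\<close> by (intro mult_left_mono) auto
        also have "\<dots> = C * (2 * (h * \<sigma>)) ^ Suc q"
          unfolding C_def by (simp add: power_add power_mult_distrib field_simps)
        also have "\<dots> \<le> C * (1/2) ^ Suc q"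
          using h \<open>\<sigma> > 0\<close> by (intro mult_left_mono power_mono) (auto simp: C_def)
        finally show ?thesis using q by simp
      qed
      \<comment> \<open>The order \<open>q\<close> is fixed before \<open>n\<close>, so only
        finitely many mixed moments have to converge.\<close>
      have "uniform_limit S (\<lambda>n. ?T (E' n)) (?T E) sequentially"
        by (intro uniform_limit_sum bounded_linear.uniform_limit[OF bounded_linear_mult_right] Suc.IH)
      then have "\<forall>\<^sub>F n in sequentially. \<forall>\<beta>\<in>S. dist (?T (E' n) \<beta>) (?T E \<beta>) < e / 3"
        by (rule uniform_limitD) (use e in auto)
      then show "\<forall>\<^sub>F n in sequentially. \<forall>\<beta>\<in>S. dist (E' n k (?t + h) \<beta>) (E k (?t + h) \<beta>) < e"
        using eventually_ge_at_top[of "k + Suc q"]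
      proof eventually_elim
        case (elim n)
        show ?case
        proof
          fix \<beta> assume \<beta>: "\<beta> \<in> S"
          have "norm (E k (?t + h) \<beta> - ?T E \<beta>) < e / 3"
            unfolding E_def E'_def
            by (rule order.strict_trans1[OF exp_moment_step[OF bM[OF \<beta>] aeM[OF \<beta>] wM t(2)] bound])
              (use h in simp)
          moreover have "norm (E' n k (?t + h) \<beta> - ?T (E' n) \<beta>) < e / 3"
          proof -
            have "h ^ Suc q / fact q * (\<integral>x. w' n x ^ (k + Suc q) \<partial>N n) < e / 3"
              using bound w_eq[of "k + Suc q" n] elim(2) by auto
            from this show ?thesis
              unfolding E_def E'_def
              by (rule order.strict_trans1[OF exp_moment_step[OF bN[OF \<beta>] aeN[OF \<beta>] wN t(2)], rotated])
                (use h in simp)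
          qed
          moreover have "norm (?T (E' n) \<beta> - ?T E \<beta>) < e / 3"
            using elim(1) \<beta> by (simp add: dist_norm)
          ultimately show "dist (E' n k (?t + h) \<beta>) (E k (?t + h) \<beta>) < e"
            unfolding dist_norm by norm
        qed
      qed
    qed
  qed
  have "real L * h = 1" using L unfolding h_def by simp
  then show ?thesis using main[of 0 L] unfolding E_def E'_def by simp
qed

section \<open>Wigner distributions of diagonal matrices\<close>

text \<open>The standard basis is an eigenbasis, so the identity serves as the orthogonal matrix;
  uniqueness then determines the \<open>THE\<close>.\<close>

lemma fun_calc_mat_diag: "fun_calc \<phi> (mat_diag m e) = mat_diag m (\<lambda>i. \<phi> (e i))"
proof -
  have "map_mat complex_of_real (1\<^sub>m m) = 1\<^sub>m m" by (rule eq_matI) auto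
  then have "is_fun_calc \<phi> (mat_diag m e) (mat_diag m (\<lambda>i. \<phi> (e i)))"
    unfolding is_fun_calc_def by (intro exI[of _ m] exI[of _ "1\<^sub>m m"] exI[of _ e])
      (simp add: left_mult_one_mat[of _ m m] right_mult_one_mat[of _ m m])
  then show ?thesis unfolding fun_calc_def by (blast intro: the_equality is_fun_calc_unique)
qed

text \<open>This is integration against the sum of point masses \<open>c k\<close> at
  \<open>x k\<close>, with indexed points so that each index can become a diagonal position of a
  matrix.\<close>

definition atomic :: "nat \<Rightarrow> (nat \<Rightarrow> real) \<Rightarrow> (nat \<Rightarrow> 'a) \<Rightarrow> ('a \<Rightarrow> complex) \<Rightarrow> complex" where
  "atomic m c x f = (\<Sum>k<m. of_real (c k) * f (x k))"

lemma compact_distribution_atomic: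
  assumes "\<And>k. c k \<ge> 0"
  shows "compact_distribution (atomic m c x)"
  unfolding compact_distribution_def
proof (intro conjI allI impI exI)
  \<comment> \<open>The distribution has order 0: point values on the set of atoms control
    it.\<close>
  show "compact (x ` {..<m})" by (intro finite_imp_compact) simp
  fix f B assume "\<forall>js y. length js \<le> 0 \<longrightarrow> y \<in> x ` {..<m} \<longrightarrow> norm (foldr rpartial js f y) \<le> B"
  then have "norm (f (x k)) \<le> B" if "k < m" for k using that by auto
  then have "norm (atomic m c x f) \<le> (\<Sum>k<m. c k * B)"
    unfolding atomic_def by (intro sum_norm_le) (use assms in \<open>auto simp: norm_mult intro!: mult_left_mono\<close>)
  then show "norm (atomic m c x f) \<le> (\<Sum>k<m. c k) * B" by (simp add: sum_distrib_right)
qed (auto simp: atomic_def algebra_simps sum.distrib sum_distrib_left)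

text \<open>If the matrices list the coordinates of the atoms on their diagonals, then
  \<open>y\<cdot>A\<close> has diagonal entries \<open>y \<bullet> x k\<close>. The quadratic form
  at \<open>u\<close> weights them by the squares of the entries of \<open>u\<close>, hence the
  square roots.\<close>

lemma wigner_distribution_atomic:
  fixes x :: "nat \<Rightarrow> real^'d"
  assumes "\<And>k. c k \<ge> 0"
  shows "wigner_distribution m (\<lambda>j. mat_diag m (\<lambda>k. x k $ j)) (Matrix.vec m (\<lambda>k. sqrt (c k))) (atomic m c x)"
  unfolding wigner_distribution_def
proof (intro conjI allI impI)
  show "real_symmetric m (mat_diag m (\<lambda>k. x k $ j))" for j
    unfolding real_symmetric_def by (auto simp: mat_diag_def intro!: eq_matI)
  show "compact_distribution (atomic m c x)" by (rule compact_distribution_atomic) fact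
  fix y :: "real^'d" and \<phi> :: "real \<Rightarrow> complex"
  let ?u = "map_vec complex_of_real (Matrix.vec m (\<lambda>k. sqrt (c k)))"
  have "lin_comb m y (\<lambda>j. mat_diag m (\<lambda>k. x k $ j)) = mat_diag m (\<lambda>k. y \<bullet> x k)"
    unfolding lin_comb_def inner_vec_def by (auto simp: mat_diag_def intro!: eq_matI)
  moreover have "(mat_diag m (\<lambda>k. \<phi> (y \<bullet> x k)) *\<^sub>v ?u) \<bullet>c ?u = (\<Sum>k<m. of_real (c k) * \<phi> (y \<bullet> x k))"
  proof -
    have "mat_diag m (\<lambda>k. \<phi> (y \<bullet> x k)) *\<^sub>v ?u = Matrix.vec m (\<lambda>k. \<phi> (y \<bullet> x k) * of_real (sqrt (c k)))"
      by (rule eq_vecI) (auto simp: mat_diag_def scalar_prod_def if_distrib[of "\<lambda>z. z * _"] cong: if_cong)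
    moreover have "of_real (sqrt (c k)) * complex_of_real (sqrt (c k)) = of_real (c k)" for k
      using assms[of k] by (simp add: of_real_mult[symmetric] del: of_real_mult)
    ultimately show ?thesis
      by (auto simp: scalar_prod_def lessThan_atLeast0 mult_ac intro!: sum.cong)
  qed
  ultimately show "atomic m c x (\<lambda>\<xi>. \<phi> (y \<bullet> \<xi>)) =
     (fun_calc \<phi> (lin_comb m y (\<lambda>j. mat_diag m (\<lambda>k. x k $ j))) *\<^sub>v ?u) \<bullet>c ?u"
    by (simp add: fun_calc_mat_diag atomic_def)
qed auto

section \<open>The bilinear pairing and Laplace transforms of finitely supported measures\<close>

lemma cdot_zero: "cdot 0 x = 0"
  by (simp add: cdot_def)

lemma cdot_add: "cdot (z + w) x = cdot z x + cdot w x"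
  by (simp add: cdot_def distrib_right sum.distrib)

lemma cdot_diff: "cdot (z - w) x = cdot z x - cdot w x"
  by (simp add: cdot_def left_diff_distrib sum_subtractf)

lemma cdot_smult: "cdot (c *s z) x = c * cdot z x"
  by (simp add: cdot_def sum_distrib_left mult.assoc)

lemma cdot_cvec: "cdot (cvec y) x = of_real (y \<bullet> x)"
  by (simp add: cdot_def cvec_def inner_vec_def)

lemma cdot_axis: "cdot (axis j w) x = w * of_real (x $ j)"
  by (simp add: cdot_def axis_def if_distrib[of "\<lambda>z. z * _"] cong: if_cong)

lemma Re_cdot: "Re (cdot z x) = Re_vec z \<bullet> x"
  by (simp add: cdot_def Re_vec_def inner_vec_def)

lemma norm_cdot_le: "norm (cdot z x) \<le> norm z * norm x"
proof -
  have "norm (cdot z x) \<le> (\<Sum>j\<in>UNIV. \<bar>norm (z $ j)\<bar> * \<bar>norm (x $ j)\<bar>)"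
    unfolding cdot_def by (rule sum_norm_le) (simp add: norm_mult)
  also have "\<dots> \<le> norm z * norm x"
    unfolding norm_vec_def by (rule order_trans[OF L2_set_mult_ineq]) simp
  finally show ?thesis .
qed

lemma bounded_linear_cdot: "bounded_linear (\<lambda>z. cdot z x)"
  by (rule bounded_linear_intro[of _ "norm x"])
    (auto simp: cdot_add norm_cdot_le, simp add: cdot_def scaleR_sum_right)

lemma entire_atomic: "entire (\<lambda>z. atomic m c x (\<lambda>\<xi>. exp (- cdot z \<xi>)))"
  unfolding entire_def
proof
  fix z
  let ?L = "\<lambda>v. \<Sum>k<m. of_real (c k) * (exp (- cdot z (x k)) * - cdot v (x k))"
  have "((\<lambda>z. exp (- cdot z \<xi>)) has_derivative (\<lambda>v. exp (- cdot z \<xi>) * - cdot v \<xi>)) (at z)" for \<xi>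
  proof -
    have "((\<lambda>z. - cdot z \<xi>) has_derivative (\<lambda>v. - cdot v \<xi>)) (at z)"
      by (intro has_derivative_minus bounded_linear_imp_has_derivative bounded_linear_cdot)
    moreover have "(exp has_derivative (*) (exp (- cdot z \<xi>))) (at (- cdot z \<xi>))"
      using DERIV_exp by (simp add: has_field_derivative_def)
    ultimately show ?thesis by (rule has_derivative_compose)
  qed
  then have "((\<lambda>z. atomic m c x (\<lambda>\<xi>. exp (- cdot z \<xi>))) has_derivative ?L) (at z)"
    unfolding atomic_def by (intro has_derivative_sum has_derivative_mult_right)
  moreover have "\<forall>a v. ?L (a *s v) = a * ?L v"
    by (simp add: cdot_smult sum_distrib_left mult_ac)
  ultimately show "\<exists>L. ((\<lambda>z. atomic m c x (\<lambda>\<xi>. exp (- cdot z \<xi>))) has_derivative L) (at z) \<and>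
      (\<forall>a v. L (a *s v) = a * L v)" by blast
qed

lemma exponential_type_atomic:
  assumes "\<And>k. c k \<ge> 0"
  shows "exponential_type (\<lambda>z. atomic m c x (\<lambda>\<xi>. exp (- cdot z \<xi>)))"
  unfolding exponential_type_def
proof (intro exI allI)
  fix z :: "complex^'a"
  \<comment> \<open>The sum of the norms dominates each of them and also makes sense for
    \<open>m = 0\<close>.\<close>
  let ?B = "\<Sum>k<m. norm (x k)"
  have "norm (exp (- cdot z (x k))) \<le> exp (?B * norm z)" if "k < m" for k
  proof -
    have "norm (x k) \<le> ?B" by (rule member_le_sum) (use that in auto)
    then have "- Re (cdot z (x k)) \<le> norm z * ?B"
      using norm_cdot_le[of z "x k"] abs_Re_le_cmod[of "cdot z (x k)"]
      by (smt (verit) mult_left_mono norm_ge_zero)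
    then show ?thesis by (simp add: mult.commute)
  qed
  then have "norm (atomic m c x (\<lambda>\<xi>. exp (- cdot z \<xi>))) \<le> (\<Sum>k<m. c k * exp (?B * norm z))"
    unfolding atomic_def
    by (intro sum_norm_le) (use assms in \<open>auto simp: norm_mult simp del: norm_exp_eq_Re intro!: mult_left_mono\<close>)
  then show "norm (atomic m c x (\<lambda>\<xi>. exp (- cdot z \<xi>))) \<le> (\<Sum>k<m. c k) * exp (?B * norm z)"
    by (simp add: sum_distrib_right)
qed

text \<open>Along a direction \<open>w\<close> the exponents are \<open>w \<bullet> x j\<close>,
  nonnegative because the atoms lie in the dual cone; the factors from the vertex \<open>p\<close>
  go into the coefficients.\<close>

lemma directional_exp_sum_atomic:
  assumes "\<And>k. c k \<ge> 0" and "\<And>k. k < m \<Longrightarrow> x k \<in> dual_cone S"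
  shows "directional_exp_sum S p (\<lambda>y. atomic m c x (\<lambda>\<xi>. exp (- cdot (cvec y) \<xi>)))"
  unfolding directional_exp_sum_def
proof (intro ballI exI[of _ m] exI conjI allI impI)
  fix w assume w: "w \<in> S"
  fix j assume "j < m"
  show "c j * exp (- (p \<bullet> x j)) \<ge> 0" using assms by simp
  show "w \<bullet> x j \<ge> 0" using assms(2)[OF \<open>j < m\<close>] w by (simp add: dual_cone_def inner_commute)
next
  fix w and t :: real
  show "atomic m c x (\<lambda>\<xi>. exp (- cdot (cvec (p + t *\<^sub>R w)) \<xi>)) =
     complex_of_real (\<Sum>j<m. c j * exp (- (p \<bullet> x j)) * exp (- (w \<bullet> x j) * t))"
    by (simp add: atomic_def cdot_cvec inner_add_left exp_add[symmetric] exp_of_real[symmetric]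
        algebra_simps)
qed

text \<open>Indexing by lists matches the encoding of multi-indices in \<open>taylor_coeff\<close>.
  Lists that are permutations of each other give the same monomial.\<close>

definition monomial :: "'d list \<Rightarrow> real^'d \<Rightarrow> real" where
  "monomial js x = (\<Prod>j\<leftarrow>js. x $ j)"

lemma monomial_Cons: "monomial (j # js) x = x $ j * monomial js x"
  by (simp add: monomial_def)

lemma foldr_cpartial_atomic:
  "foldr cpartial js (\<lambda>z. atomic m c x (\<lambda>\<xi>. exp (- cdot z \<xi>))) =
     (\<lambda>z. atomic m c x (\<lambda>\<xi>. (- 1) ^ length js * of_real (monomial js \<xi>) * exp (- cdot z \<xi>)))"
proof (induction js)
  case Nil
  show ?case by (simp add: monomial_def)
next
  case (Cons j js)
  show ?case
    unfolding foldr.simps comp_def Cons.IH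
    unfolding cpartial_def atomic_def
    by (intro ext DERIV_imp_deriv)
      (auto intro!: derivative_eq_intros sum.cong simp: cdot_add cdot_axis monomial_def)
qed

section \<open>Laplace transforms of measures of moderate growth\<close>

lemma power_le_fact_exp:
  assumes "(y::real) \<ge> 0"
  shows "y ^ k \<le> fact k * exp y"
proof -
  have "(\<Sum>i\<in>{k}. y ^ i /\<^sub>R fact i) \<le> (\<Sum>i. y ^ i /\<^sub>R fact i)"
    by (rule sum_le_suminf) (use assms summable_exp_generic[of y] in auto)
  then show ?thesis by (simp add: exp_def field_simps)
qed

text \<open>Moving from \<open>p\<close> a fixed distance against the direction of \<open>x\<close>
  stays in the cone, and pairing the resulting point with \<open>x\<close> gives the bound. It lets
  \<open>p \<bullet> x\<close> control the norm wherever the measure lives.\<close>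

lemma interior_cone_coercive:
  assumes "p \<in> interior \<Gamma>"
  shows "\<exists>r>0. \<forall>x\<in>dual_cone \<Gamma>. r * norm x \<le> p \<bullet> x"
proof -
  obtain e where e: "e > 0" "cball p e \<subseteq> \<Gamma>"
    using assms mem_interior_cball by blast
  have "e * norm x \<le> p \<bullet> x" if x: "x \<in> dual_cone \<Gamma>" for x
  proof (cases "x = 0")
    case False
    have "p - (e / norm x) *\<^sub>R x \<in> \<Gamma>"
      using e False by (intro subsetD[OF e(2)]) (auto simp: dist_norm)
    then have "0 \<le> x \<bullet> (p - (e / norm x) *\<^sub>R x)"
      using x unfolding dual_cone_def by auto
    then show ?thesis using False
      by (simp add: inner_diff_right inner_commute power2_norm_eq_inner[symmetric] power2_eq_square)
  qed simp
  then show ?thesis using e(1) by blast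
qed

text \<open>Used with \<open>a = 1/2\<close>: half of an exponential weight absorbs a growing
  factor, and the other half is still integrable by moderate growth.\<close>

lemma cone_interior_scaleR:
  fixes \<Gamma> :: "'a::real_normed_vector set"
  assumes "cone \<Gamma>" "q \<in> interior \<Gamma>" "a > 0"
  shows "a *\<^sub>R q \<in> interior \<Gamma>"
proof -
  have "(*\<^sub>R) a ` interior \<Gamma> \<subseteq> interior \<Gamma>"
  proof (rule interior_maximal)
    show "(*\<^sub>R) a ` interior \<Gamma> \<subseteq> \<Gamma>"
      using assms(1,3) interior_subset[of \<Gamma>] unfolding cone_def by auto
    show "open ((*\<^sub>R) a ` interior \<Gamma>)"
      using assms(3) by (intro open_scaling) auto
  qed
  then show ?thesis using assms(2) by blast
qed

text \<open>The second-order Taylor remainder of the exponential is integrated directly, giving an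
  error quadratic in \<open>h\<close>.\<close>

lemma has_field_derivative_integral_exp:
  fixes g :: "'a \<Rightarrow> complex" and y :: "'a \<Rightarrow> real"
  assumes [measurable]: "g \<in> borel_measurable M" "y \<in> borel_measurable M"
    and int: "integrable M (\<lambda>x. norm (g x) * exp (\<delta> * \<bar>y x\<bar>))" and "\<delta> > 0"
  shows "((\<lambda>h. \<integral>x. g x * exp (- (h * of_real (y x))) \<partial>M)
    has_field_derivative (\<integral>x. g x * - of_real (y x) \<partial>M)) (at 0)"
proof -
  let ?G = "\<lambda>h. \<integral>x. g x * exp (- (h * of_real (y x))) \<partial>M"
  let ?D = "\<integral>x. g x * - of_real (y x) \<partial>M"
  let ?I = "\<integral>x. norm (g x) * exp (\<delta> * \<bar>y x\<bar>) \<partial>M"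
  \<comment> \<open>The constant comes from \<open>power_le_fact_exp\<close> with exponent 2 at
    \<open>\<delta> / 2 * \<bar>y x\<bar>\<close>.\<close>
  define C where "C = 2 * (2 / \<delta>)\<^sup>2"
  have C: "C \<ge> 0" unfolding C_def by simp
  have y1: "\<bar>y x\<bar> \<le> (1 / \<delta>) * exp (\<delta> * \<bar>y x\<bar>)" for x
    using power_le_fact_exp[of "\<delta> * \<bar>y x\<bar>" 1] \<open>\<delta> > 0\<close> by (simp add: field_simps)
  have y2: "\<bar>y x\<bar>\<^sup>2 \<le> C * exp (\<delta> / 2 * \<bar>y x\<bar>)" for x
    using power_le_fact_exp[of "\<delta> / 2 * \<bar>y x\<bar>" 2] \<open>\<delta> > 0\<close> unfolding C_def
    by (simp add: field_simps power2_eq_square)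
  have expb: "norm (exp (- (h * of_real (y x)))) \<le> exp (\<delta> * \<bar>y x\<bar>)" if "norm h \<le> \<delta>" for h :: complex and x
  proof -
    have "norm (- (h * of_real (y x))) \<le> \<delta> * \<bar>y x\<bar>"
      using that by (simp add: norm_mult mult_right_mono)
    then show ?thesis using abs_Re_le_cmod[of "- (h * of_real (y x))"] by (simp del: norm_minus_cancel)
  qed
  have int_exp: "integrable M (\<lambda>x. g x * exp (- (h * of_real (y x))))" if "norm h \<le> \<delta>" for h
    using expb[OF that] by (intro Bochner_Integration.integrable_bound[OF int])
      (auto simp: norm_mult simp del: norm_exp_eq_Re intro!: mult_left_mono)
  have int_y: "integrable M (\<lambda>x. g x * - of_real (y x))"
  proof (rule Bochner_Integration.integrable_bound[OF integrable_mult_right[OF int, of "1 / \<delta>"]])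
    show "AE x in M. norm (g x * - of_real (y x)) \<le> norm (1 / \<delta> * (norm (g x) * exp (\<delta> * \<bar>y x\<bar>)))"
      using mult_left_mono[OF y1, of "norm (g _)"] \<open>\<delta> > 0\<close> by (auto simp: norm_mult abs_mult)
  qed simp
  \<comment> \<open>Restricting \<open>h\<close> to half the radius spends half of the exponential
    weight on the Taylor remainder and leaves the other half for the square of
    \<open>y x\<close>.\<close>
  have bound: "norm (?G h - ?G 0 - h * ?D) \<le> norm h ^ 2 * (C * ?I)" if h: "norm h \<le> \<delta> / 2" for h
  proof -
    have h': "norm h \<le> \<delta>" using h \<open>\<delta> > 0\<close> by simp
    have int0: "integrable M g" using int_exp[of 0] \<open>\<delta> > 0\<close> by simp
    have "?G h - ?G 0 - h * ?D
        = (\<integral>x. g x * exp (- (h * of_real (y x))) - g x - h * (g x * - of_real (y x)) \<partial>M)"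
      using int_exp[OF h'] int0 int_y by simp
    also have "norm \<dots> \<le> (\<integral>x. norm h ^ 2 * (C * (norm (g x) * exp (\<delta> * \<bar>y x\<bar>))) \<partial>M)"
    proof (rule order_trans[OF integral_norm_bound integral_mono])
      show "integrable M (\<lambda>x. norm (g x * exp (- (h * of_real (y x))) - g x - h * (g x * - of_real (y x))))"
        using int_exp[OF h'] int0 int_y by (intro integrable_norm) simp
      show "integrable M (\<lambda>x. norm h ^ 2 * (C * (norm (g x) * exp (\<delta> * \<bar>y x\<bar>))))"
        by (intro integrable_mult_right int)
      fix x assume "x \<in> space M"
      let ?u = "- (h * of_real (y x))"
      have nu: "norm ?u \<le> \<delta> / 2 * \<bar>y x\<bar>"
        using mult_right_mono[OF h, of "\<bar>y x\<bar>"] by (simp add: norm_mult)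
      have "norm (exp ?u - 1 - ?u) \<le> exp (norm ?u) * norm ?u ^ 2"
        using Taylor_exp_field[of ?u 1] by (simp add: algebra_simps power2_eq_square)
      also have "\<dots> \<le> exp (\<delta> / 2 * \<bar>y x\<bar>) * (norm h ^ 2 * (C * exp (\<delta> / 2 * \<bar>y x\<bar>)))"
        using nu mult_left_mono[OF y2[of x], of "norm h ^ 2"]
        by (intro mult_mono) (auto simp: norm_mult power_mult_distrib)
      also have "\<dots> = norm h ^ 2 * (C * exp (\<delta> * \<bar>y x\<bar>))"
        by (simp add: exp_add[symmetric] mult.left_commute[of "exp _"])
      finally have "norm (g x) * norm (exp ?u - 1 - ?u)
          \<le> norm (g x) * (norm h ^ 2 * (C * exp (\<delta> * \<bar>y x\<bar>)))"
        by (rule mult_left_mono) simp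
      then show "norm (g x * exp ?u - g x - h * (g x * - of_real (y x)))
          \<le> norm h ^ 2 * (C * (norm (g x) * exp (\<delta> * \<bar>y x\<bar>)))"
        by (simp add: norm_mult[symmetric] algebra_simps)
    qed
    also have "\<dots> = norm h ^ 2 * (C * ?I)" using int by simp
    finally show ?thesis .
  qed
  have "((\<lambda>h. (?G (0 + h) - ?G 0) / h - ?D) \<longlongrightarrow> 0) (at 0)"
  proof (rule Lim_null_comparison)
    show "\<forall>\<^sub>F h in at 0. norm ((?G (0 + h) - ?G 0) / h - ?D) \<le> norm h * (C * ?I)"
      unfolding eventually_at
    proof (intro exI[of _ "\<delta> / 2"] conjI ballI impI)
      fix h :: complex assume h: "h \<noteq> 0 \<and> dist h 0 < \<delta> / 2"
      have "norm ((?G (0 + h) - ?G 0) / h - ?D) = norm (?G h - ?G 0 - h * ?D) / norm h"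
        using h by (simp add: norm_divide[symmetric] diff_divide_distrib add_divide_distrib)
      also have "\<dots> \<le> norm h * (C * ?I)"
        using bound[of h] h by (simp add: divide_le_eq power2_eq_square mult_ac)
      finally show "norm ((?G (0 + h) - ?G 0) / h - ?D) \<le> norm h * (C * ?I)" .
    qed (use \<open>\<delta> > 0\<close> in simp)
    show "((\<lambda>h. norm h * (C * ?I)) \<longlongrightarrow> 0) (at (0::complex))"
      by (auto intro!: tendsto_eq_intros)
  qed
  then show ?thesis unfolding DERIV_def LIM_zero_iff .
qed

lemma abs_monomial_le: "\<bar>monomial js x\<bar> \<le> norm x ^ length js"
proof (induction js)
  case (Cons j js)
  then show ?case
    using component_le_norm_cart[of x j] unfolding monomial_def by (auto simp: abs_mult intro!: mult_mono)
qed (simp add: monomial_def)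

lemma borel_measurable_monomial[measurable]: "monomial js \<in> borel_measurable borel"
proof (induction js)
  case (Cons j js)
  then show ?case unfolding monomial_def by simp
qed (simp add: monomial_def[abs_def])

lemma borel_measurable_cdot[measurable]: "cdot z \<in> borel_measurable borel"
  unfolding cdot_def[abs_def] by simp

lemma closed_dual_cone: "closed (dual_cone S)"
proof -
  have "dual_cone S = (\<Inter>x\<in>S. {y. y \<bullet> x \<ge> 0})" unfolding dual_cone_def by auto
  then show ?thesis by (auto intro!: closed_INT closed_Collect_le continuous_intros)
qed

section \<open>Integrability and derivatives for measures of moderate growth\<close>

locale moderate_measure =
  fixes \<Gamma> :: "(real^'d) set" and \<mu> :: "(real^'d) measure"
  assumes cone: "cone \<Gamma>" and growth: "moderate_growth \<Gamma> \<mu>"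
begin

lemma sets_\<mu>[measurable_cong]: "sets \<mu> = sets borel"
  using growth unfolding moderate_growth_def by blast

lemma dual_cone_sets: "dual_cone \<Gamma> \<in> sets borel"
  by (rule borel_closed[OF closed_dual_cone])

lemma AE_dual_cone: "AE x in \<mu>. x \<in> dual_cone \<Gamma>"
proof (rule AE_I)
  show "emeasure \<mu> (- dual_cone \<Gamma>) = 0" using growth unfolding moderate_growth_def by blast
  show "- dual_cone \<Gamma> \<in> sets \<mu>" using dual_cone_sets by (simp add: sets_\<mu> borel_comp)
qed auto

lemma integrable_exp:
  assumes "q \<in> interior \<Gamma>"
  shows "integrable \<mu> (\<lambda>x. exp (- (q \<bullet> x)))"
proof -
  have "integrable \<mu> (\<lambda>x. indicator (dual_cone \<Gamma>) x *\<^sub>R exp (- (q \<bullet> x)))"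
    using growth assms unfolding moderate_growth_def set_integrable_def by blast
  then show ?thesis
    by (rule integrable_cong_AE_imp) (use AE_dual_cone in auto)
qed

lemma integrable_norm_power_exp:
  assumes q: "q \<in> interior \<Gamma>"
  shows "integrable \<mu> (\<lambda>x. norm x ^ k * exp (- (q \<bullet> x)))"
proof -
  obtain r where r: "r > 0" "\<And>x. x \<in> dual_cone \<Gamma> \<Longrightarrow> r * norm x \<le> q \<bullet> x"
    using interior_cone_coercive[OF q] by blast
  have "integrable \<mu> (\<lambda>x. exp (- ((1/2) *\<^sub>R q \<bullet> x)))"
    by (intro integrable_exp cone_interior_scaleR cone q) simp
  then show ?thesis
  proof (rule Bochner_Integration.integrable_bound[OF integrable_mult_right[where c="(2 / r) ^ k * fact k"]])
    show "AE x in \<mu>. norm (norm x ^ k * exp (- (q \<bullet> x)))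
        \<le> norm ((2 / r) ^ k * fact k * exp (- ((1/2) *\<^sub>R q \<bullet> x)))"
      using AE_dual_cone
    proof eventually_elim
      case (elim x)
      have "norm x ^ k = (2 / r) ^ k * (r / 2 * norm x) ^ k"
        using r(1) by (simp add: power_mult_distrib[symmetric])
      also have "\<dots> \<le> (2 / r) ^ k * (fact k * exp (r / 2 * norm x))"
        using r(1) by (intro mult_left_mono power_le_fact_exp) auto
      also have "\<dots> \<le> (2 / r) ^ k * (fact k * exp (q \<bullet> x / 2))"
        using r(1) r(2)[OF elim] by (intro mult_left_mono) auto
      finally have "norm x ^ k * exp (- (q \<bullet> x)) \<le> (2 / r) ^ k * (fact k * exp (q \<bullet> x / 2)) * exp (- (q \<bullet> x))"
        by (rule mult_right_mono) simp
      also have "\<dots> = (2 / r) ^ k * fact k * exp (- ((1/2) *\<^sub>R q \<bullet> x))"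
        by (simp add: mult.assoc exp_add[symmetric])
      finally show ?case using r(1) by (simp add: abs_mult)
    qed
  qed simp
qed

lemma laplace_measure_eq: "laplace_measure \<Gamma> \<mu> z = (\<integral>x. exp (- cdot z x) \<partial>\<mu>)"
proof -
  have [measurable]: "dual_cone \<Gamma> \<in> sets borel" by (rule dual_cone_sets)
  show ?thesis unfolding laplace_measure_def set_lebesgue_integral_def
    by (rule integral_cong_AE) (use AE_dual_cone in auto)
qed

lemma has_field_derivative_laplace_moment:
  assumes z: "z \<in> tube (interior \<Gamma>)"
  shows "((\<lambda>w. \<integral>x. (- 1) ^ length js * of_real (monomial js x) * exp (- cdot (z + axis j w) x) \<partial>\<mu>)
    has_field_derivative
    (\<integral>x. (- 1) ^ length (j # js) * of_real (monomial (j # js) x) * exp (- cdot z x) \<partial>\<mu>)) (at 0)"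
proof -
  define q where "q = Re_vec z"
  have q: "q \<in> interior \<Gamma>" using z by (simp add: q_def tube_def)
  obtain r where r: "r > 0" "\<And>x. x \<in> dual_cone \<Gamma> \<Longrightarrow> r * norm x \<le> q \<bullet> x"
    using interior_cone_coercive[OF q] by blast
  define g where "g = (\<lambda>x. (- 1) ^ length js * of_real (monomial js x) * exp (- cdot z x))"
  have [measurable]: "g \<in> borel_measurable \<mu>" unfolding g_def by measurable
  have "((\<lambda>w. \<integral>x. g x * exp (- (w * of_real (x $ j))) \<partial>\<mu>)
    has_field_derivative (\<integral>x. g x * - of_real (x $ j) \<partial>\<mu>)) (at 0)"
  proof (rule has_field_derivative_integral_exp)
    \<comment> \<open>The radius is \<open>r / 2\<close>: by coercivity the extra exponential costs
      at most half of \<open>q \<bullet> x\<close>, and the other half makes the monomial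
      integrable.\<close>
    have "(1/2) *\<^sub>R q \<in> interior \<Gamma>" by (intro cone_interior_scaleR cone q) simp
    from integrable_norm_power_exp[OF this, of "length js"]
    show "integrable \<mu> (\<lambda>x. norm (g x) * exp (r / 2 * \<bar>x $ j\<bar>))"
    proof (rule Bochner_Integration.integrable_bound)
      show "AE x in \<mu>. norm (norm (g x) * exp (r / 2 * \<bar>x $ j\<bar>))
          \<le> norm (norm x ^ length js * exp (- ((1/2) *\<^sub>R q \<bullet> x)))"
        using AE_dual_cone
      proof eventually_elim
        case (elim x)
        have "r * \<bar>x $ j\<bar> \<le> q \<bullet> x"
          using r(2)[OF elim] component_le_norm_cart[of x j] r(1) by (smt (verit) mult_left_mono)
        then have "\<bar>monomial js x\<bar> * (exp (- (q \<bullet> x)) * exp (r / 2 * \<bar>x $ j\<bar>))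
            \<le> norm x ^ length js * exp (- (q \<bullet> x) + q \<bullet> x / 2)"
          unfolding exp_add[symmetric] by (intro mult_mono abs_monomial_le) auto
        moreover have "norm (g x) = \<bar>monomial js x\<bar> * exp (- (q \<bullet> x))"
          by (simp add: g_def norm_mult norm_power Re_cdot q_def)
        ultimately show ?case by (simp add: abs_mult mult.assoc)
      qed
    qed measurable
  qed (use r(1) in auto)
  moreover have "g x * exp (- (w * of_real (x $ j)))
      = (- 1) ^ length js * of_real (monomial js x) * exp (- cdot (z + axis j w) x)" for w x
    unfolding g_def cdot_add cdot_axis by (simp add: mult.assoc exp_add[symmetric])
  moreover have "g x * - of_real (x $ j)
      = (- 1) ^ length (j # js) * of_real (monomial (j # js) x) * exp (- cdot z x)" for x
    unfolding g_def by (simp add: monomial_def)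
  ultimately show ?thesis by simp
qed

lemma foldr_cpartial_laplace_measure:
  assumes "z \<in> tube (interior \<Gamma>)"
  shows "foldr cpartial js (laplace_measure \<Gamma> \<mu>) z =
    (\<integral>x. (- 1) ^ length js * of_real (monomial js x) * exp (- cdot z x) \<partial>\<mu>)"
  using assms
proof (induction js arbitrary: z)
  case Nil
  show ?case by (simp add: laplace_measure_eq monomial_def)
next
  case (Cons j js)
  \<comment> \<open>The outer derivative depends on the inner one near \<open>z\<close>, so the
    induction hypothesis is needed on a neighbourhood; it is available because the tube is
    open.\<close>
  have "\<forall>\<^sub>F w in nhds 0. z + axis j w \<in> tube (interior \<Gamma>)"
  proof -
    have "Re_vec (z + axis j w) = Re_vec z + Re w *\<^sub>R axis j 1" for w
      unfolding Finite_Cartesian_Product.vec_eq_iff by (simp add: Re_vec_def axis_def)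
    then have "isCont (\<lambda>w. Re_vec (z + axis j w)) 0"
      by (simp add: continuous_intros)
    then have "((\<lambda>w. Re_vec (z + axis j w)) \<longlongrightarrow> Re_vec (z + axis j 0)) (nhds 0)"
      unfolding continuous_at using tendsto_at_iff_tendsto_nhds by blast
    moreover have "Re_vec (z + axis j 0) \<in> interior \<Gamma>"
      using Cons.prems by (simp add: tube_def axis_def Re_vec_def)
    ultimately show ?thesis unfolding tube_def
      using topological_tendstoD[of _ _ _ "interior \<Gamma>"] by auto
  qed
  then have "\<forall>\<^sub>F w in nhds 0. foldr cpartial js (laplace_measure \<Gamma> \<mu>) (z + axis j w) =
      (\<integral>x. (- 1) ^ length js * of_real (monomial js x) * exp (- cdot (z + axis j w) x) \<partial>\<mu>)"
    by eventually_elim (rule Cons.IH)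
  then have "foldr cpartial (j # js) (laplace_measure \<Gamma> \<mu>) z =
      deriv (\<lambda>w. \<integral>x. (- 1) ^ length js * of_real (monomial js x) * exp (- cdot (z + axis j w) x) \<partial>\<mu>) 0"
    by (simp add: cpartial_def) (intro deriv_cong_ev refl)
  also have "\<dots> = (\<integral>x. (- 1) ^ length (j # js) * of_real (monomial (j # js) x) * exp (- cdot z x) \<partial>\<mu>)"
    by (intro DERIV_imp_deriv has_field_derivative_laplace_moment Cons.prems)
  finally show ?case .
qed

end

section \<open>Quadrature for the tilted measure\<close>

text \<open>Summing over words instead of multi-indices avoids multinomial coefficients. Thus
  matching monomial moments matches the moments of every linear form.\<close>

lemma cdot_power:
  "cdot b x ^ k = (\<Sum>js | length js = k. (\<Prod>j\<leftarrow>js. b $ j) * of_real (monomial js x))"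
proof (induction k)
  case 0
  have "{js :: 'a list. length js = 0} = {[]}" by auto
  then show ?case by (simp add: monomial_def)
next
  case (Suc k)
  let ?t = "\<lambda>js. (\<Prod>j\<leftarrow>js. b $ j) * of_real (monomial js x)"
  have "bij_betw (\<lambda>(j, js). j # js) (UNIV \<times> {js :: 'a list. length js = k}) {js. length js = Suc k}"
    by (rule bij_betwI[where g="\<lambda>js. (hd js, tl js)"]) (auto simp: length_Suc_conv)
  then have "(\<Sum>js | length js = Suc k. ?t js) = (\<Sum>(j, js)\<in>UNIV \<times> {js. length js = k}. ?t (j # js))"
    by (subst sum.reindex_bij_betw[symmetric]) (auto intro: sum.cong)
  also have "\<dots> = (\<Sum>j\<in>UNIV. \<Sum>js | length js = k. ?t (j # js))"
    by (rule sum.cartesian_product[symmetric])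
  also have "\<dots> = cdot b x * cdot b x ^ k"
    unfolding Suc.IH unfolding cdot_def sum_product by (simp add: monomial_Cons mult_ac)
  finally show ?case by simp
qed

lemma integral_point_measure_lessThan:
  fixes g :: "nat \<Rightarrow> 'b::{banach, second_countable_topology}"
  assumes "\<And>k. a k \<ge> 0"
  shows "(\<integral>k. g k \<partial>point_measure {..<m} (\<lambda>k. ennreal (a k))) = (\<Sum>k<m. a k *\<^sub>R g k)"
  using assms by (intro lebesgue_integral_point_measure_finite) auto

context moderate_measure
begin

text \<open>Absorbing the factor \<open>exp (- p\<cdot>x)\<close> into the measure moves the expansion point \<open>p\<close> to the
  origin and makes all moments finite.\<close>

definition tilt :: "real^'d \<Rightarrow> (real^'d) measure" where
  "tilt p = density \<mu> (\<lambda>x. ennreal (exp (- (p \<bullet> x))))"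

lemma sets_tilt[measurable_cong]: "sets (tilt p) = sets borel"
  by (simp add: tilt_def sets_\<mu>)

lemma integral_tilt:
  fixes f :: "_ \<Rightarrow> 'b::{banach, second_countable_topology}"
  assumes [measurable]: "f \<in> borel_measurable borel"
  shows "integrable (tilt p) f \<longleftrightarrow> integrable \<mu> (\<lambda>x. exp (- (p \<bullet> x)) *\<^sub>R f x)"
    and "(\<integral>x. f x \<partial>tilt p) = (\<integral>x. exp (- (p \<bullet> x)) *\<^sub>R f x \<partial>\<mu>)"
  unfolding tilt_def by (subst integrable_density, auto) (subst integral_density, auto)

lemma AE_tilt: "AE x in tilt p. x \<in> dual_cone \<Gamma>"
  unfolding tilt_def by (subst AE_density) (use AE_dual_cone in auto)

lemma integrable_tilt_norm_power:
  assumes "p \<in> interior \<Gamma>"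
  shows "integrable (tilt p) (\<lambda>x. norm x ^ k)"
  using integrable_norm_power_exp[OF assms, of k] by (subst integral_tilt(1)) (auto simp: mult.commute)

lemma integrable_tilt_monomial:
  assumes "p \<in> interior \<Gamma>"
  shows "integrable (tilt p) (monomial js)"
  by (rule Bochner_Integration.integrable_bound[OF integrable_tilt_norm_power[OF assms, of "length js"]])
    (auto simp: abs_monomial_le)

lemma integral_tilt_cdot_power:
  assumes "p \<in> interior \<Gamma>"
  shows "(\<integral>x. cdot b x ^ k \<partial>tilt p) =
    (\<Sum>js | length js = k. (\<Prod>j\<leftarrow>js. b $ j) * of_real (\<integral>x. monomial js x \<partial>tilt p))"
  unfolding cdot_power using integrable_tilt_monomial[OF assms] by (simp add: integral_complex_of_real)

lemma finite_measure_tilt: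
  assumes "p \<in> interior \<Gamma>"
  shows "finite_measure (tilt p)"
proof -
  \<comment> \<open>The majorant is the zeroth power of the norm, which is constantly 1.\<close>
  have "integrable (tilt p) (indicator (space (tilt p)) :: _ \<Rightarrow> real)"
    by (rule Bochner_Integration.integrable_bound[OF integrable_tilt_norm_power[OF assms, of 0]])
      (auto simp: indicator_def)
  then show ?thesis by (intro finite_measureI) (simp add: integrable_indicator_iff less_top[symmetric])
qed

lemma laplace_measure_tilt:
  "laplace_measure \<Gamma> \<mu> z = (\<integral>x. exp (- cdot (z - cvec p) x) \<partial>tilt p)"
  unfolding laplace_measure_eq
  by (subst integral_tilt(2))
    (auto simp: cdot_diff cdot_cvec scaleR_conv_of_real exp_of_real[symmetric] exp_add[symmetric])

text \<open>Up to sign, derivatives at \<open>p\<close> are moments of the tilted measure, so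
  matching Taylor coefficients is a moment problem.\<close>

lemma foldr_cpartial_laplace_measure_tilt:
  assumes "p \<in> interior \<Gamma>"
  shows "foldr cpartial js (laplace_measure \<Gamma> \<mu>) (cvec p) =
    (- 1) ^ length js * of_real (\<integral>x. monomial js x \<partial>tilt p)"
proof -
  have "cvec p \<in> tube (interior \<Gamma>)"
    using assms by (simp add: tube_def Re_vec_def cvec_def)
  then have "foldr cpartial js (laplace_measure \<Gamma> \<mu>) (cvec p) =
    (\<integral>x. (- 1) ^ length js * of_real (exp (- (p \<bullet> x)) * monomial js x) \<partial>\<mu>)"
    by (subst foldr_cpartial_laplace_measure) (simp_all add: cdot_cvec exp_of_real[symmetric] mult_ac)
  also have "\<dots> = (- 1) ^ length js * of_real (\<integral>x. monomial js x \<partial>tilt p)"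
    by (subst integral_tilt(2)) (simp_all add: integral_complex_of_real del: of_real_mult)
  finally show ?thesis .
qed

lemma quadrature:
  assumes p: "p \<in> interior \<Gamma>"
  shows "\<exists>m a (x :: nat \<Rightarrow> real^'d). (\<forall>k. a k \<ge> 0) \<and> (\<forall>k<m. x k \<in> dual_cone \<Gamma>) \<and>
    (\<forall>js. length js \<le> L \<longrightarrow> (\<Sum>k<m. a k * monomial js (x k)) = (\<integral>x. monomial js x \<partial>tilt p))"
proof -
  have fin: "finite {js :: 'd list. length js \<le> L}"
    using finite_lists_length_le[of "UNIV :: 'd set" L] by simp
  have "dual_cone \<Gamma> \<in> sets (tilt p)" using dual_cone_sets sets_tilt by simp
  from Tchakaloff[where f=monomial, OF finite_measure_tilt[OF p] this AE_tilt fin integrable_tilt_monomial[OF p]]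
  obtain A c where A: "finite A" "A \<subseteq> dual_cone \<Gamma>" "\<forall>x. c x \<ge> 0"
    and eq: "\<forall>js\<in>{js. length js \<le> L}. (\<Sum>x\<in>A. c x * monomial js x) = (\<integral>x. monomial js x \<partial>tilt p)"
    by blast
  \<comment> \<open>\<open>atomic\<close> needs atoms indexed by an initial segment of the
    naturals.\<close>
  obtain e where e: "bij_betw e {..<card A} A"
    using ex_bij_betw_nat_finite[OF A(1)] by (auto simp: lessThan_atLeast0)
  have "(\<Sum>k<card A. c (e k) * monomial js (e k)) = (\<Sum>x\<in>A. c x * monomial js x)" for js
    by (rule sum.reindex_bij_betw[OF e])
  then show ?thesis
    using A eq e by (intro exI[of _ "card A"] exI[of _ "\<lambda>k. c (e k)"] exI[of _ e])
      (auto dest!: bij_betwE)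
qed

text \<open>Half of the weight \<open>exp (- (p \<bullet> x))\<close> absorbs the power through
  \<open>power_le_fact_exp\<close>. This supplies the growth hypothesis of
  \<open>uniform_limit_exp_moments\<close> with \<sigma> equal to \<open>2 * C\<close>.\<close>

lemma integral_tilt_inner_power_le:
  assumes p: "p \<in> interior \<Gamma>" and "C > 0"
  shows "integrable (tilt p) (\<lambda>x. (C * (p \<bullet> x)) ^ j)"
    and "(\<integral>x. (C * (p \<bullet> x)) ^ j \<partial>tilt p) \<le> (\<integral>x. exp (- ((1/2) *\<^sub>R p \<bullet> x)) \<partial>\<mu>) * (2 * C) ^ j * fact j"
proof -
  have half: "integrable \<mu> (\<lambda>x. exp (- ((1/2) *\<^sub>R p \<bullet> x)))"
    by (intro integrable_exp cone_interior_scaleR cone p) simp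
  have bound: "AE x in \<mu>. 0 \<le> exp (- (p \<bullet> x)) * (C * (p \<bullet> x)) ^ j \<and>
      exp (- (p \<bullet> x)) * (C * (p \<bullet> x)) ^ j \<le> exp (- ((1/2) *\<^sub>R p \<bullet> x)) * ((2 * C) ^ j * fact j)"
    using AE_dual_cone
  proof eventually_elim
    case (elim x)
    have px: "p \<bullet> x \<ge> 0"
      using elim p interior_subset[of \<Gamma>] by (auto simp: dual_cone_def inner_commute)
    have "(C * (p \<bullet> x)) ^ j = (2 * C) ^ j * (p \<bullet> x / 2) ^ j"
      using power_mult_distrib[of "2 * C" "p \<bullet> x / 2" j] by simp
    also have "\<dots> \<le> (2 * C) ^ j * (fact j * exp (p \<bullet> x / 2))"
      using px \<open>C > 0\<close> by (intro mult_left_mono power_le_fact_exp) auto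
    finally have "exp (- (p \<bullet> x)) * (C * (p \<bullet> x)) ^ j
        \<le> exp (- (p \<bullet> x)) * ((2 * C) ^ j * (fact j * exp (p \<bullet> x / 2)))"
      by (rule mult_left_mono) simp
    also have "\<dots> = (exp (- (p \<bullet> x)) * exp (p \<bullet> x / 2)) * ((2 * C) ^ j * fact j)" by (simp only: mult_ac)
    also have "exp (- (p \<bullet> x)) * exp (p \<bullet> x / 2) = exp (- ((1/2) *\<^sub>R p \<bullet> x))"
      by (simp add: exp_add[symmetric])
    finally show ?case using px \<open>C > 0\<close> by simp
  qed
  have int: "integrable \<mu> (\<lambda>x. exp (- (p \<bullet> x)) * (C * (p \<bullet> x)) ^ j)"
    by (rule Bochner_Integration.integrable_bound[OF integrable_mult_left[OF half, of "(2 * C) ^ j * fact j"]])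
      (measurable, use bound in \<open>eventually_elim, auto\<close>)
  then show "integrable (tilt p) (\<lambda>x. (C * (p \<bullet> x)) ^ j)"
    by (subst integral_tilt(1)) auto
  have "(\<integral>x. (C * (p \<bullet> x)) ^ j \<partial>tilt p) = (\<integral>x. exp (- (p \<bullet> x)) * (C * (p \<bullet> x)) ^ j \<partial>\<mu>)"
    by (subst integral_tilt(2)) auto
  also have "\<dots> \<le> (\<integral>x. exp (- ((1/2) *\<^sub>R p \<bullet> x)) * ((2 * C) ^ j * fact j) \<partial>\<mu>)"
    by (rule integral_mono_AE[OF int integrable_mult_left[OF half]]) (use bound in auto)
  finally show "(\<integral>x. (C * (p \<bullet> x)) ^ j \<partial>tilt p)
      \<le> (\<integral>x. exp (- ((1/2) *\<^sub>R p \<bullet> x)) \<partial>\<mu>) * (2 * C) ^ j * fact j"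
    by (simp add: mult.assoc)
qed

text \<open>The majorant is the linear form \<open>C * (p \<bullet> y)\<close> rather than a
  multiple of the norm, because its powers are polynomials and so their integrals are matched by the
  quadrature.\<close>

lemma uniform_limit_atomic:
  fixes m :: "nat \<Rightarrow> nat" and a :: "nat \<Rightarrow> nat \<Rightarrow> real" and x :: "nat \<Rightarrow> nat \<Rightarrow> real^'d"
  assumes p: "p \<in> interior \<Gamma>" and a: "\<And>n k. a n k \<ge> 0" and x: "\<And>n k. k < m n \<Longrightarrow> x n k \<in> dual_cone \<Gamma>"
    and mom: "\<And>n js. length js \<le> 2 * n + 1 \<Longrightarrow>
      (\<Sum>k<m n. a n k * monomial js (x n k)) = (\<integral>x. monomial js x \<partial>tilt p)"
    and K: "compact K" "K \<subseteq> tube ((+) p ` \<Gamma>)"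
  shows "uniform_limit K (\<lambda>n z. \<Sum>k<m n. a n k *\<^sub>R exp (- cdot (z - cvec p) (x n k)))
    (laplace_measure \<Gamma> \<mu>) sequentially"
proof -
  obtain r where r: "r > 0" "\<And>x. x \<in> dual_cone \<Gamma> \<Longrightarrow> r * norm x \<le> p \<bullet> x"
    using interior_cone_coercive[OF p] by blast
  have "compact ((\<lambda>z. z - cvec p) ` K)"
    using K(1) by (intro compact_continuous_image continuous_intros)
  then obtain R where R: "R > 0" "\<And>z. z \<in> K \<Longrightarrow> norm (z - cvec p) \<le> R"
    using compact_imp_bounded[of "(\<lambda>z. z - cvec p) ` K"] unfolding bounded_pos by auto
  \<comment> \<open>\<open>R\<close> bounds \<open>z - cvec p\<close> on \<open>K\<close>, and
    \<open>r\<close> converts the norm of a point of the dual cone into its pairing with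
    \<open>p\<close>.\<close>
  define C where "C = R / r"
  have C: "C > 0" using R r by (simp add: C_def)
  have dom: "0 \<le> Re (cdot (z - cvec p) y) \<and> norm (cdot (z - cvec p) y) \<le> C * (p \<bullet> y)"
    if z: "z \<in> K" and y: "y \<in> dual_cone \<Gamma>" for z y
  proof
    obtain g where g: "g \<in> \<Gamma>" "Re_vec z = p + g" using z K(2) by (auto simp: tube_def)
    have "Re_vec (z - cvec p) = g"
      using g(2) by (simp add: Re_vec_def cvec_def Finite_Cartesian_Product.vec_eq_iff)
    then show "0 \<le> Re (cdot (z - cvec p) y)"
      using g(1) y by (simp add: Re_cdot dual_cone_def inner_commute)
    have "norm (cdot (z - cvec p) y) \<le> R * norm y"
      using norm_cdot_le[of "z - cvec p" y] R(2)[OF z] by (meson mult_right_mono norm_ge_zero order_trans)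
    also have "\<dots> = C * (r * norm y)" using r(1) by (simp add: C_def)
    also have "\<dots> \<le> C * (p \<bullet> y)" using r(2)[OF y] C by (intro mult_left_mono) auto
    finally show "norm (cdot (z - cvec p) y) \<le> C * (p \<bullet> y)" .
  qed
  define N where "N = (\<lambda>n. point_measure {..<m n} (\<lambda>k. ennreal (a n k)))"
  have N: "(\<integral>k. g k \<partial>N n) = (\<Sum>k<m n. a n k *\<^sub>R g k)"
    for g :: "nat \<Rightarrow> 'b::{banach, second_countable_topology}" and n
    unfolding N_def by (rule integral_point_measure_lessThan[OF a])
  have pw: "(\<integral>k. cdot b (x n k) ^ j \<partial>N n) = (\<integral>y. cdot b y ^ j \<partial>tilt p)" if j: "j \<le> 2 * n + 1" for b n j
  proof -
    have "(\<integral>k. cdot b (x n k) ^ j \<partial>N n)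
        = (\<Sum>js | length js = j. (\<Prod>j\<leftarrow>js. b $ j) * of_real (\<Sum>k<m n. a n k * monomial js (x n k)))"
      unfolding N cdot_power scaleR_sum_right sum_distrib_left of_real_sum
      by (subst sum.swap) (simp add: scaleR_conv_of_real mult_ac)
    also have "\<dots> = (\<integral>y. cdot b y ^ j \<partial>tilt p)"
      unfolding integral_tilt_cdot_power[OF p] using mom j by (intro sum.cong) auto
    finally show ?thesis .
  qed
  have "uniform_limit K (\<lambda>n z. \<integral>k. exp (- cdot (z - cvec p) (x n k)) \<partial>N n)
      (\<lambda>z. \<integral>y. exp (- cdot (z - cvec p) y) \<partial>tilt p) sequentially"
  proof (rule uniform_limit_exp_moments[where w="\<lambda>y. C * (p \<bullet> y)" and w'="\<lambda>n k. C * (p \<bullet> x n k)"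
        and \<sigma>="2 * C"])
    fix z assume z: "z \<in> K"
    show "cdot (z - cvec p) \<in> borel_measurable (tilt p)" by measurable
    show "AE y in tilt p. 0 \<le> Re (cdot (z - cvec p) y) \<and> norm (cdot (z - cvec p) y) \<le> C * (p \<bullet> y)"
      using AE_tilt by eventually_elim (rule dom[OF z])
    fix n
    show "(\<lambda>k. cdot (z - cvec p) (x n k)) \<in> borel_measurable (N n)"
      unfolding N_def by simp
    show "AE k in N n. 0 \<le> Re (cdot (z - cvec p) (x n k)) \<and>
        norm (cdot (z - cvec p) (x n k)) \<le> C * (p \<bullet> x n k)"
      by (rule AE_I2, rule dom[OF z], rule x) (simp add: N_def space_point_measure)
    show "(\<integral>k. cdot (z - cvec p) (x n k) ^ j \<partial>N n) = (\<integral>y. cdot (z - cvec p) y ^ j \<partial>tilt p)"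
      if "j \<le> 2 * n + 1" for j by (rule pw[OF that])
  next
    fix j
    show "integrable (tilt p) (\<lambda>y. (C * (p \<bullet> y)) ^ j)"
      by (rule integral_tilt_inner_power_le(1)[OF p C])
    show "(\<integral>y. (C * (p \<bullet> y)) ^ j \<partial>tilt p)
        \<le> (\<integral>x. exp (- ((1/2) *\<^sub>R p \<bullet> x)) \<partial>\<mu>) * (2 * C) ^ j * fact j"
      by (rule integral_tilt_inner_power_le(2)[OF p C])
    fix n
    show "integrable (N n) (\<lambda>k. (C * (p \<bullet> x n k)) ^ j)"
      unfolding N_def by (rule integrable_point_measure_finite) simp
    assume "j \<le> 2 * n + 1"
    \<comment> \<open>The majorant is itself a pairing, with the real vector
      \<open>C *\<^sub>R p\<close>, so \<open>pw\<close> applies after passing to complex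
      values.\<close>
    have "complex_of_real (\<integral>k. (C * (p \<bullet> x n k)) ^ j \<partial>N n) = (\<integral>k. cdot (cvec (C *\<^sub>R p)) (x n k) ^ j \<partial>N n)"
      by (simp add: integral_complex_of_real[symmetric] cdot_cvec)
    also have "\<dots> = complex_of_real (\<integral>y. (C * (p \<bullet> y)) ^ j \<partial>tilt p)"
      unfolding pw[OF \<open>j \<le> 2 * n + 1\<close>] by (simp add: integral_complex_of_real[symmetric] cdot_cvec)
    finally show "(\<integral>k. (C * (p \<bullet> x n k)) ^ j \<partial>N n) = (\<integral>y. (C * (p \<bullet> y)) ^ j \<partial>tilt p)"
      by (simp only: of_real_eq_iff)
  qed (use C in auto)
  then show ?thesis unfolding N laplace_measure_tilt[of _ p] .
qed

end

section \<open>Assembly of the approximating sequence\<close>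

theorem theorem6p2:
  fixes \<Gamma> :: "(real^'d) set" and \<mu> :: "(real^'d) measure" and p :: "real^'d"
  assumes "closed \<Gamma>" and "convex \<Gamma>" and "cone \<Gamma>" and "acute \<Gamma>" and "interior \<Gamma> \<noteq> {}"
    and "moderate_growth \<Gamma> \<mu>"
    and "p \<in> interior \<Gamma>"
  shows "\<exists>(W :: nat \<Rightarrow> (real^'d \<Rightarrow> complex) \<Rightarrow> complex) (F :: nat \<Rightarrow> complex^'d \<Rightarrow> complex).
     (\<forall>n. (\<exists>m A u. wigner_distribution m A u (W n)) \<and>
          F n = laplace_distribution (W n) \<and>
          (\<forall>js. length js \<le> 2 * n + 1 \<longrightarrow>
             taylor_coeff js (F n) (cvec p) = taylor_coeff js (laplace_measure \<Gamma> \<mu>) (cvec p)) \<and>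
          entire (F n) \<and> exponential_type (F n) \<and>
          directional_exp_sum \<Gamma> p (\<lambda>x. F n (cvec x))) \<and>
     (\<forall>K. compact K \<longrightarrow> K \<subseteq> tube ((+) p ` interior \<Gamma>) \<longrightarrow>
        uniform_limit K F (laplace_measure \<Gamma> \<mu>) sequentially)"
proof -
  interpret moderate_measure \<Gamma> \<mu> by standard fact+
  note p = \<open>p \<in> interior \<Gamma>\<close>
  obtain m a and x :: "nat \<Rightarrow> nat \<Rightarrow> real^'d" where a: "\<And>n k. a n k \<ge> 0"
    and x: "\<And>n k. k < m n \<Longrightarrow> x n k \<in> dual_cone \<Gamma>"
    and mom: "\<And>n js. length js \<le> 2 * n + 1 \<Longrightarrow>
      (\<Sum>k<m n. a n k * monomial js (x n k)) = (\<integral>x. monomial js x \<partial>tilt p)"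
    using quadrature[OF p, of "2 * n + 1" for n] by metis
  \<comment> \<open>The exponential factor undoes the tilt: these weights at \<open>z\<close> give
    the same terms as the quadrature weights \<open>a\<close> at \<open>z - cvec p\<close>.\<close>
  define c where "c = (\<lambda>n k. a n k * exp (p \<bullet> x n k))"
  have c: "c n k \<ge> 0" for n k using a by (simp add: c_def)
  define W where "W = (\<lambda>n. atomic (m n) (c n) (x n))"
  define F where "F = (\<lambda>n. laplace_distribution (W n))"
  have F: "F n = (\<lambda>z. atomic (m n) (c n) (x n) (\<lambda>\<xi>. exp (- cdot z \<xi>)))" for n
    by (simp add: F_def W_def laplace_distribution_def fun_eq_iff)
  have exp_c: "of_real (c n k) * exp (- cdot z (x n k)) = of_real (a n k) * exp (- cdot (z - cvec p) (x n k))"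
    for n k z
    by (simp add: c_def cdot_diff cdot_cvec exp_of_real[symmetric] mult.assoc exp_add[symmetric])
  have "wigner_distribution (m n) (\<lambda>j. mat_diag (m n) (\<lambda>k. x n k $ j))
      (Matrix.vec (m n) (\<lambda>k. sqrt (c n k))) (W n)" for n
    unfolding W_def by (rule wigner_distribution_atomic[OF c])
  moreover have "taylor_coeff js (F n) (cvec p) = taylor_coeff js (laplace_measure \<Gamma> \<mu>) (cvec p)"
    if "length js \<le> 2 * n + 1" for n js
  proof -
    have "foldr cpartial js (F n) (cvec p) =
        (\<Sum>k<m n. (- 1) ^ length js * of_real (monomial js (x n k)) *
          (of_real (c n k) * exp (- cdot (cvec p) (x n k))))"
      unfolding F foldr_cpartial_atomic by (simp add: atomic_def mult_ac)
    also have "\<dots> = (- 1) ^ length js * of_real (\<Sum>k<m n. a n k * monomial js (x n k))"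
      unfolding exp_c by (simp add: cdot_zero sum_distrib_left mult_ac)
    finally show ?thesis
      unfolding taylor_coeff_def foldr_cpartial_laplace_measure_tilt[OF p] mom[OF that] by simp
  qed
  moreover have "entire (F n)" "exponential_type (F n)" "directional_exp_sum \<Gamma> p (\<lambda>x. F n (cvec x))" for n
    unfolding F using entire_atomic exponential_type_atomic[OF c] directional_exp_sum_atomic[OF c x] by auto
  moreover have "uniform_limit K F (laplace_measure \<Gamma> \<mu>) sequentially"
    if "compact K" "K \<subseteq> tube ((+) p ` interior \<Gamma>)" for K
  proof -
    have "K \<subseteq> tube ((+) p ` \<Gamma>)" using that(2) interior_subset[of \<Gamma>] by (auto simp: tube_def)
    note uniform_limit_atomic[where m=m and a=a and x=x, OF p a x mom that(1) this]
    moreover have "F = (\<lambda>n z. \<Sum>k<m n. a n k *\<^sub>R exp (- cdot (z - cvec p) (x n k)))"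
      by (intro ext) (simp add: F atomic_def exp_c scaleR_conv_of_real)
    ultimately show ?thesis by simp
  qed
  ultimately show ?thesis
    by (intro exI[of _ W] exI[of _ F]) (auto simp: F_def)
qed

end
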